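(* Let $g\in C^0(\partial\Omega)$. The global problem $$\text{(G)}\qquad u\in L^\infty(\Omega),\quad \Delta u=0\ \text{in }\Omega,\quad u=g\ \text{on }\partial\Omega$$ and the domain decomposition problem $$\text{(D)}\qquad u_j\in L^\infty(\Omega_j),\quad \Delta u_j=0\ \text{in }\Omega_j,\quad u_j=g\ \text{on }\Gamma_j^{\rm ext},\quad u_j=\sum_{i\in N_j}u_i\chi_j^i\ \text{on }\partial\Omega_j\setminus\Gamma_j^{\rm ext}\qquad(j=1,\dots,N)$$ are equivalent: if $u$ is the solution of (G), then $(u|_{\Omega_1},\dots,u|_{\Omega_N})$ is a solution of (D), and it is the only solution of (D). Therefore the parallel Schwarz method converges to the solution $u$ of (G): for every continuous $u_0:\overline\Omega\to\mathbb R$, the sequences defined by $u_j^0=u_0|_{\Omega_j}$ and, for $n\ge0$ and $j=1,\dots,N$, $u_j^{n+1}\in L^\infty(\Omega_j)$, $$\Delta u_j^{n+1}=0\ \text{in }\Omega_j,\quad u_j^{n+1}=g\ \text{on }\Gamma_j^{\rm ext},\quad u_j^{n+1}=\sum_{i\in N_j}u_i^n\chi_j^i\ \text{on }\partial\Omega_j\setminus\Gamma_j^{\rm ext},$$ satisfy $\displaystyle\lim_{n\to\infty}\max_{j=1,\dots,N}\operatorname*{ess\,sup}_{\mathcal S_j}|u-u_j^n|=0$.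
   Context: **Geometry.** $N>1$, and $\Omega_1,\dots,\Omega_N\subset\mathbb R^2$ are open disks of radii $r_i>0$ such that $\Omega=\bigcup_{i=1}^N\Omega_i$ is connected and at least two of the disks intersect. Standing assumptions: (A1) if $\Omega_i\cap\Omega_j\neq\emptyset$ ($i\ne j$), there are sets of positive (arclength) measure $\Gamma_i\subset\partial\Omega_i\cap\Omega_j$ and $\Gamma_j\subset\partial\Omega_j\cap\Omega_i$ with $\Gamma_i\cap\Omega_k=\emptyset=\Gamma_j\cap\Omega_k$ for all $k\in\{1,\dots,N\}\setminus\{i,j\}$; (A2) $\Omega_{i_1}\cap\Omega_{i_2}\cap\Omega_{i_3}\cap\Omega_{i_4}=\emptyset$ for all distinct $i_1,i_2,i_3,i_4$. **Boundaries and skeletons.** For each $j$: $\Gamma_j^{\rm ext}=\partial\Omega_j\cap\partial\Omega$, $\Gamma_j^{\rm int}=\overline{\partial\Omega_j\setminus\Gamma_j^{\rm ext}}$, $N_j=\{i\ne j:\Omega_i\cap\Omega_j\ne\emptyset\}$, and for $k\in N_j$, $N_{jk}=(N_j\cap N_k)\cup\{0\}$. For $k\in N_j$, $i\in N_{jk}$ (interiors relative to $\partial\Omega_j$): $\Gamma_j^{k,i}={\rm int}\{x\in\partial\Omega_j: x\in\Omega_k\cap\Omega_i\}$ if $i\neq0$, and $\Gamma_j^{k,0}={\rm int}\{x\in\partial\Omega_j: x\in\Omega_k,\ x\notin\Omega_\ell\ \forall \ell\in N_j\setminus\{k\}\}$. For $k\in N_j$: $\mathcal S_{j,k}=\overline{\bigcup_{i\in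 N_{jk}}\Gamma_k^{j,i}}$ (the part of $\partial\Omega_k$ lying in $\overline{\Omega_j}$, obtained as the closure of the part in $\Omega_j$). The skeleton of $\Omega_j$ is $\mathcal S_j=\bigcup_{k\in N_j}\mathcal S_{j,k}$, with arclength measure. **Partition of unity.** Fixed functions $\chi_j^k:\partial\Omega_j\to\mathbb R$ ($k\in N_j$), continuous on ${\rm int}(\Gamma_j^{\rm int})$ (interior relative to $\partial\Omega_j$), with $\chi_j^k=1$ on $\overline{\Gamma_j^{k,0}}\setminus\Gamma_j^{\rm ext}$, $\chi_j^k\in[0,1]$ on $\overline{\Gamma_j^{k,i}}\setminus\Gamma_j^{\rm ext}$ for $0\ne i\in N_{jk}$, $\chi_j^k=0$ otherwise, and $\sum_{k\in N_j}\chi_j^k=1$ on ${\rm int}(\Gamma_j^{\rm int})$. (If $\Gamma_j^{\rm ext}$ has an isolated point, the prescription at that point is modified by making at least one $\chi_j^k$ nonzero there, keeping the continuity requirement.) On $\partial\Omega_j\setminus\Gamma_j^{\rm ext}$, the product $u_i\chi_j^i$ is understood as $0$ where $\chi_j^i=0$. **Boundary conditions.** Boundary data may be discontinuous at finitely many points. All solutions are bounded harmonic functions, and the Dirichlet conditions are understood in the usual sense for such functions: the boundary values are attained as limits at all but finitely many boundary points (on a disk the solution is the Poisson integral of its data). *)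

theory Defs
  imports "HOL-Analysis.Analysis" "HOL-Probability.Essential_Supremum"
begin

text \<open>The plane is \<^typ>\<open>complex\<close>. Functions on a subset of the plane are total HOL functions of which
  only the values on that subset are constrained. Disks are indexed by \<open>{1..N}\<close>, so the
  index \<open>0\<close> is free to serve as the extra element of \<open>N\<^bsub>jk\<^esub>\<close>.\<close>

subsection \<open>Bounded harmonic functions and Dirichlet conditions\<close>

text \<open>\<open>C\<^sup>2\<close> with vanishing Laplacian; \<open>G\<close> is the gradient and \<open>H\<close> the Hessian
  (\<open>S\<close> is always an open set).\<close>

definition harmonic_on :: "('a::euclidean_space \<Rightarrow> real) \<Rightarrow> 'a set \<Rightarrow> bool" where
  "harmonic_on u S \<longleftrightarrow>
    (\<exists>(G :: 'a \<Rightarrow> 'a) (H :: 'a \<Rightarrow> 'a \<Rightarrow> 'a).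
      (\<forall>x\<in>S. (u has_derivative (\<lambda>h. G x \<bullet> h)) (at x)) \<and>
      (\<forall>x\<in>S. (G has_derivative H x) (at x)) \<and>
      (\<forall>b\<in>Basis. continuous_on S (\<lambda>x. H x b)) \<and>
      (\<forall>x\<in>S. (\<Sum>b\<in>Basis. H x b \<bullet> b) = 0))"

text \<open>A harmonic function is continuous, so on an open set it lies in \<open>L\<^sup>\<infinity>\<close> iff it is bounded.\<close>

definition bounded_harmonic_on :: "('a::euclidean_space \<Rightarrow> real) \<Rightarrow> 'a set \<Rightarrow> bool" where
  "bounded_harmonic_on u S \<longleftrightarrow> harmonic_on u S \<and> bounded (u ` S)"

text \<open>\<open>u = f\<close> on \<open>\<Gamma> \<subseteq> \<partial>S\<close> for \<open>u\<close> defined in \<open>S\<close>: the boundary value is attained as a limit from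
  within \<open>S\<close> at all but finitely many points of \<open>\<Gamma>\<close>.\<close>

definition dirichlet_on :: "('a::euclidean_space \<Rightarrow> real) \<Rightarrow> 'a set \<Rightarrow> 'a set \<Rightarrow> ('a \<Rightarrow> real) \<Rightarrow> bool" where
  "dirichlet_on u S \<Gamma> f \<longleftrightarrow> finite {x \<in> \<Gamma>. \<not> (u \<longlongrightarrow> f x) (at x within S)}"

subsection \<open>Arclength\<close>

definition circle_measure :: "complex \<Rightarrow> real \<Rightarrow> complex measure" where
  "circle_measure a \<rho> = scale_measure (ennreal \<rho>)
    (distr (restrict_space lborel {0..<2*pi}) borel (\<lambda>t. a + complex_of_real \<rho> * cis t))"

text \<open>Arclength on the union of the circles: the sum of the arclength measures of the individual
  circles. (Distinct circles meet in at most two points, so nothing is counted twice.)\<close>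

definition arclength :: "nat \<Rightarrow> (nat \<Rightarrow> complex) \<Rightarrow> (nat \<Rightarrow> real) \<Rightarrow> complex measure" where
  "arclength N c r = measure_of UNIV (sets borel) (\<lambda>A. \<Sum>i\<in>{1..N}. emeasure (circle_measure (c i) (r i)) A)"

lemma sets_circle_measure [simp]: "sets (circle_measure a \<rho>) = sets borel"
  by (simp add: circle_measure_def)

lemma sets_arclength [simp]: "sets (arclength N c r) = sets borel"
  unfolding arclength_def using sets.sigma_sets_eq[of "borel :: complex measure"]
  by (simp add: sets_measure_of_conv)

lemma emeasure_arclength:
  assumes "A \<in> sets borel"
  shows "emeasure (arclength N c r) A = (\<Sum>i\<in>{1..N}. emeasure (circle_measure (c i) (r i)) A)"
  unfolding arclength_def
proof (rule emeasure_measure_of_sigma)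
  show "sigma_algebra UNIV (sets (borel :: complex measure))"
    using sets.sigma_algebra_axioms[of "borel :: complex measure"] by simp
  show "positive (sets borel) (\<lambda>A. \<Sum>i\<in>{1..N}. emeasure (circle_measure (c i) (r i)) A)"
    by (simp add: positive_def)
  show "countably_additive (sets borel) (\<lambda>A. \<Sum>i\<in>{1..N}. emeasure (circle_measure (c i) (r i)) A)"
  proof (rule countably_additiveI)
    fix B :: "nat \<Rightarrow> complex set"
    assume B: "range B \<subseteq> sets borel" "disjoint_family B"
    have "(\<Sum>n. \<Sum>i\<in>{1..N}. emeasure (circle_measure (c i) (r i)) (B n)) =
          (\<Sum>i\<in>{1..N}. \<Sum>n. emeasure (circle_measure (c i) (r i)) (B n))"
      by (rule suminf_sum) auto
    also have "\<dots> = (\<Sum>i\<in>{1..N}. emeasure (circle_measure (c i) (r i)) (\<Union>n. B n))"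
      using B by (intro sum.cong refl suminf_emeasure) auto
    finally show "(\<Sum>n. \<Sum>i\<in>{1..N}. emeasure (circle_measure (c i) (r i)) (B n)) =
          (\<Sum>i\<in>{1..N}. emeasure (circle_measure (c i) (r i)) (\<Union>n. B n))" .
  qed
  show "A \<in> sets borel" by fact
qed

subsection \<open>Disks, boundaries and skeletons\<close>

definition disk :: "(nat \<Rightarrow> complex) \<Rightarrow> (nat \<Rightarrow> real) \<Rightarrow> nat \<Rightarrow> complex set" where
  "disk c r j = ball (c j) (r j)"

definition domain :: "nat \<Rightarrow> (nat \<Rightarrow> complex) \<Rightarrow> (nat \<Rightarrow> real) \<Rightarrow> complex set" where
  "domain N c r = (\<Union>j\<in>{1..N}. disk c r j)"

definition disk_configuration :: "nat \<Rightarrow> (nat \<Rightarrow> complex) \<Rightarrow> (nat \<Rightarrow> real) \<Rightarrow> bool" where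
  "disk_configuration N c r \<longleftrightarrow>
    N > 1 \<and> (\<forall>i\<in>{1..N}. r i > 0) \<and> connected (domain N c r) \<and>
    (\<exists>i\<in>{1..N}. \<exists>j\<in>{1..N}. i \<noteq> j \<and> disk c r i \<inter> disk c r j \<noteq> {})"

definition assumption_A1 :: "nat \<Rightarrow> (nat \<Rightarrow> complex) \<Rightarrow> (nat \<Rightarrow> real) \<Rightarrow> bool" where
  "assumption_A1 N c r \<longleftrightarrow>
    (\<forall>i\<in>{1..N}. \<forall>j\<in>{1..N}. i \<noteq> j \<and> disk c r i \<inter> disk c r j \<noteq> {} \<longrightarrow>
      (\<exists>\<Gamma>i \<Gamma>j.
        \<Gamma>i \<in> sets borel \<and> \<Gamma>i \<subseteq> frontier (disk c r i) \<inter> disk c r j \<and>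
        emeasure (circle_measure (c i) (r i)) \<Gamma>i > 0 \<and>
        \<Gamma>j \<in> sets borel \<and> \<Gamma>j \<subseteq> frontier (disk c r j) \<inter> disk c r i \<and>
        emeasure (circle_measure (c j) (r j)) \<Gamma>j > 0 \<and>
        (\<forall>k\<in>{1..N} - {i, j}. \<Gamma>i \<inter> disk c r k = {} \<and> \<Gamma>j \<inter> disk c r k = {})))"

definition assumption_A2 :: "nat \<Rightarrow> (nat \<Rightarrow> complex) \<Rightarrow> (nat \<Rightarrow> real) \<Rightarrow> bool" where
  "assumption_A2 N c r \<longleftrightarrow>
    (\<forall>i1\<in>{1..N}. \<forall>i2\<in>{1..N}. \<forall>i3\<in>{1..N}. \<forall>i4\<in>{1..N}. distinct [i1, i2, i3, i4] \<longrightarrow>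
      disk c r i1 \<inter> disk c r i2 \<inter> disk c r i3 \<inter> disk c r i4 = {})"

definition ext_bd :: "nat \<Rightarrow> (nat \<Rightarrow> complex) \<Rightarrow> (nat \<Rightarrow> real) \<Rightarrow> nat \<Rightarrow> complex set" where
  "ext_bd N c r j = frontier (disk c r j) \<inter> frontier (domain N c r)"

definition int_bd :: "nat \<Rightarrow> (nat \<Rightarrow> complex) \<Rightarrow> (nat \<Rightarrow> real) \<Rightarrow> nat \<Rightarrow> complex set" where
  "int_bd N c r j = closure (frontier (disk c r j) - ext_bd N c r j)"

text \<open>Interior relative to \<open>\<partial>\<Omega>\<^sub>j\<close>.\<close>

definition bd_interior :: "(nat \<Rightarrow> complex) \<Rightarrow> (nat \<Rightarrow> real) \<Rightarrow> nat \<Rightarrow> complex set \<Rightarrow> complex set" where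
  "bd_interior c r j A = (top_of_set (frontier (disk c r j))) interior_of A"

definition nbrs :: "nat \<Rightarrow> (nat \<Rightarrow> complex) \<Rightarrow> (nat \<Rightarrow> real) \<Rightarrow> nat \<Rightarrow> nat set" where
  "nbrs N c r j = {i\<in>{1..N}. i \<noteq> j \<and> disk c r i \<inter> disk c r j \<noteq> {}}"

definition common_nbrs0 :: "nat \<Rightarrow> (nat \<Rightarrow> complex) \<Rightarrow> (nat \<Rightarrow> real) \<Rightarrow> nat \<Rightarrow> nat \<Rightarrow> nat set" where
  "common_nbrs0 N c r j k = (nbrs N c r j \<inter> nbrs N c r k) \<union> {0}"

text \<open>\<open>arc N c r j k i\<close> is \<open>\<Gamma>\<^sub>j\<^bsup>k,i\<^esup>\<close>.\<close>

definition arc :: "nat \<Rightarrow> (nat \<Rightarrow> complex) \<Rightarrow> (nat \<Rightarrow> real) \<Rightarrow> nat \<Rightarrow> nat \<Rightarrow> nat \<Rightarrow> complex set" where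
  "arc N c r j k i = bd_interior c r j
    (if i \<noteq> 0 then {x \<in> frontier (disk c r j). x \<in> disk c r k \<inter> disk c r i}
     else {x \<in> frontier (disk c r j). x \<in> disk c r k \<and> (\<forall>l \<in> nbrs N c r j - {k}. x \<notin> disk c r l)})"

definition skeleton_part :: "nat \<Rightarrow> (nat \<Rightarrow> complex) \<Rightarrow> (nat \<Rightarrow> real) \<Rightarrow> nat \<Rightarrow> nat \<Rightarrow> complex set" where
  "skeleton_part N c r j k = closure (\<Union>i \<in> common_nbrs0 N c r j k. arc N c r k j i)"

definition skeleton :: "nat \<Rightarrow> (nat \<Rightarrow> complex) \<Rightarrow> (nat \<Rightarrow> real) \<Rightarrow> nat \<Rightarrow> complex set" where
  "skeleton N c r j = (\<Union>k \<in> nbrs N c r j. skeleton_part N c r j k)"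

definition skeleton_esssup ::
  "nat \<Rightarrow> (nat \<Rightarrow> complex) \<Rightarrow> (nat \<Rightarrow> real) \<Rightarrow> nat \<Rightarrow> (complex \<Rightarrow> real) \<Rightarrow> ereal" where
  "skeleton_esssup N c r j f =
    esssup (restrict_space (arclength N c r) (skeleton N c r j)) (\<lambda>x. ereal (f x))"

subsection \<open>Partition of unity\<close>

text \<open>\<open>chi j k\<close> is \<open>\<chi>\<^sub>j\<^sup>k\<close>. The isolated points of \<open>\<Gamma>\<^sub>j\<^sup>e\<^sup>x\<^sup>t\<close> belong to the relative interior of
  \<open>\<Gamma>\<^sub>j\<^sup>i\<^sup>n\<^sup>t\<close> and to none of the sets \<open>closure (arc N c r j k i) - ext_bd N c r j\<close>; there the
  clause ``zero otherwise'' is replaced by ``not all zero'', while continuity and the sum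
  condition remain in force.\<close>

definition partition_of_unity ::
  "nat \<Rightarrow> (nat \<Rightarrow> complex) \<Rightarrow> (nat \<Rightarrow> real) \<Rightarrow> (nat \<Rightarrow> nat \<Rightarrow> complex \<Rightarrow> real) \<Rightarrow> bool" where
  "partition_of_unity N c r chi \<longleftrightarrow>
    (\<forall>j\<in>{1..N}.
      (\<forall>k \<in> nbrs N c r j.
        continuous_on (bd_interior c r j (int_bd N c r j)) (chi j k) \<and>
        (\<forall>x \<in> closure (arc N c r j k 0) - ext_bd N c r j. chi j k x = 1) \<and>
        (\<forall>i \<in> common_nbrs0 N c r j k - {0}. \<forall>x \<in> closure (arc N c r j k i) - ext_bd N c r j.
           chi j k x \<in> {0..1}) \<and>
        (\<forall>x \<in> frontier (disk c r j).
           x \<notin> (\<Union>i \<in> common_nbrs0 N c r j k. closure (arc N c r j k i) - ext_bd N c r j) \<and>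
           \<not> x isolated_in ext_bd N c r j \<longrightarrow> chi j k x = 0)) \<and>
      (\<forall>x. x isolated_in ext_bd N c r j \<longrightarrow> (\<exists>k \<in> nbrs N c r j. chi j k x \<noteq> 0)) \<and>
      (\<forall>x \<in> bd_interior c r j (int_bd N c r j). (\<Sum>k \<in> nbrs N c r j. chi j k x) = 1))"

subsection \<open>The global problem, the decomposed problem and the Schwarz iteration\<close>

definition solves_global ::
  "nat \<Rightarrow> (nat \<Rightarrow> complex) \<Rightarrow> (nat \<Rightarrow> real) \<Rightarrow> (complex \<Rightarrow> real) \<Rightarrow> (complex \<Rightarrow> real) \<Rightarrow> bool" where
  "solves_global N c r g u \<longleftrightarrow>
    bounded_harmonic_on u (domain N c r) \<and>
    dirichlet_on u (domain N c r) (frontier (domain N c r)) g"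

text \<open>\<open>w\<close> solves the problem in \<open>\<Omega>\<^sub>j\<close> with interface data taken from \<open>v i\<close>, \<open>i \<in> N\<^sub>j\<close>. In the sum, the
  points where \<open>chi j i x \<noteq> 0\<close> but \<open>x \<notin> \<Omega>\<^sub>i\<close> are finitely many (they lie on \<open>\<partial>\<Omega>\<^sub>i \<inter> \<partial>\<Omega>\<^sub>j\<close>), so the
  values of \<open>v i\<close> outside \<open>\<Omega>\<^sub>i\<close> do not affect the condition.\<close>

definition solves_local ::
  "nat \<Rightarrow> (nat \<Rightarrow> complex) \<Rightarrow> (nat \<Rightarrow> real) \<Rightarrow> (nat \<Rightarrow> nat \<Rightarrow> complex \<Rightarrow> real) \<Rightarrow> (complex \<Rightarrow> real) \<Rightarrow>
   nat \<Rightarrow> (nat \<Rightarrow> complex \<Rightarrow> real) \<Rightarrow> (complex \<Rightarrow> real) \<Rightarrow> bool" where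
  "solves_local N c r chi g j v w \<longleftrightarrow>
    bounded_harmonic_on w (disk c r j) \<and>
    dirichlet_on w (disk c r j) (ext_bd N c r j) g \<and>
    dirichlet_on w (disk c r j) (frontier (disk c r j) - ext_bd N c r j)
      (\<lambda>x. \<Sum>i \<in> nbrs N c r j. v i x * chi j i x)"

definition solves_decomposed ::
  "nat \<Rightarrow> (nat \<Rightarrow> complex) \<Rightarrow> (nat \<Rightarrow> real) \<Rightarrow> (nat \<Rightarrow> nat \<Rightarrow> complex \<Rightarrow> real) \<Rightarrow> (complex \<Rightarrow> real) \<Rightarrow>
   (nat \<Rightarrow> complex \<Rightarrow> real) \<Rightarrow> bool" where
  "solves_decomposed N c r chi g v \<longleftrightarrow> (\<forall>j\<in>{1..N}. solves_local N c r chi g j v (v j))"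

text \<open>\<open>U n j\<close> is \<open>u\<^sub>j\<^sup>n\<close>.\<close>

definition schwarz_iterates ::
  "nat \<Rightarrow> (nat \<Rightarrow> complex) \<Rightarrow> (nat \<Rightarrow> real) \<Rightarrow> (nat \<Rightarrow> nat \<Rightarrow> complex \<Rightarrow> real) \<Rightarrow> (complex \<Rightarrow> real) \<Rightarrow>
   (complex \<Rightarrow> real) \<Rightarrow> (nat \<Rightarrow> nat \<Rightarrow> complex \<Rightarrow> real) \<Rightarrow> bool" where
  "schwarz_iterates N c r chi g u0 U \<longleftrightarrow>
    (\<forall>j\<in>{1..N}. \<forall>x \<in> disk c r j. U 0 j x = u0 x) \<and>
    (\<forall>n. \<forall>j\<in>{1..N}. solves_local N c r chi g j (U n) (U (Suc n) j))"

end

theory Submission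
  imports Defs "HOL-Complex_Analysis.Cauchy_Integral_Formula"
begin

text \<open>Let \<open>e\<^sub>j = u - u\<^sub>j\<close> be the error of a decomposed solution, or of one step of the iteration. Since the
\<open>\<chi>\<^sub>j\<^sup>i\<close> add up to \<open>1\<close> on the interface \<open>\<partial>\<Omega>\<^sub>j - \<Gamma>\<^sub>j\<^sup>e\<^sup>x\<^sup>t\<close>, the new error is a bounded harmonic function on \<open>\<Omega>\<^sub>j\<close>
whose boundary values are \<open>0\<close> on \<open>\<Gamma>\<^sub>j\<^sup>e\<^sup>x\<^sup>t\<close> and \<open>\<Sum>\<^sub>i e\<^sub>i \<chi>\<^sub>j\<^sup>i\<close> on the interface
(\<open>error_solves_local\<close>). Uniqueness and convergence both follow once this map is shown to contract
a weighted supremum over the interfaces: for uniqueness it is applied to a constant sequence of errors.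

The weight is \<open>\<phi> z = 1 + R\<^sup>2 - |z|\<^sup>2\<close>, which is strictly superharmonic and at least \<open>1\<close> on the closure of
\<open>\<Omega>\<close>. Its harmonic extension \<open>\<alpha>\<^sub>j\<close> from \<open>\<partial>\<Omega>\<^sub>j\<close> is affine and lies below \<open>\<phi>\<close> inside \<open>\<Omega>\<^sub>j\<close>, by exactly
\<open>r\<^sub>j\<^sup>2 - |z - c\<^sub>j|\<^sup>2\<close>. If the interface data are bounded by \<open>K \<phi>\<close>, then by the maximum principle the
new errors satisfy \<open>|e\<^sub>i| \<le> K \<alpha>\<^sub>i < K \<phi>\<close> in \<open>\<Omega>\<^sub>i\<close>, so something is gained at every point of \<open>\<partial>\<Omega>\<^sub>j\<close> that
lies in \<open>\<Omega>\<^sub>i\<close>. The gain tends to \<open>0\<close> at \<open>\<partial>\<Omega>\<^sub>i\<close>, and the point is to make it uniform over the interface.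
Its closure is compact, so a local statement at each of its points \<open>P\<close> suffices.

If \<open>P \<in> \<Omega>\<close>, then \<open>\<chi>\<^sub>j\<^sup>i\<close> vanishes at \<open>P\<close> unless \<open>P \<in> \<Omega>\<^sub>i\<close> (\<open>chi_eq_0_outside\<close>): by (A1) intersecting disks
have transversal boundary circles, hence \<open>\<partial>\<Omega>\<^sub>j\<close> contains points outside the closure of \<open>\<Omega>\<^sub>i\<close>
arbitrarily close to \<open>P\<close>, where \<open>\<chi>\<^sub>j\<^sup>i = 0\<close>, and \<open>\<chi>\<^sub>j\<^sup>i\<close> is continuous. Thus the gain is lost only where the
weight \<open>\<chi>\<^sub>j\<^sup>i\<close> is small (\<open>interface_bound_near_interior\<close>).

If \<open>P \<in> \<partial>\<Omega>\<close>, all \<open>\<chi>\<^sub>j\<^sup>i\<close> would vanish at \<open>P\<close> by the same argument, so \<open>P\<close> cannot lie in the relative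
interior of \<open>\<Gamma>\<^sub>j\<^sup>i\<^sup>n\<^sup>t\<close> (\<open>Int_bd_eq\<close>). Consequently, if two circles cross at \<open>P\<close>, then near \<open>P\<close> one
of the two sides of \<open>P\<close> on each of them belongs to \<open>\<partial>\<Omega>\<close> (\<open>corner_side_exterior\<close>). There the errors vanish, and the argument of
\<open>(z - P) / (c\<^sub>i - P)\<close> yields a harmonic barrier that is bounded away from \<open>0\<close> along any circle that
crosses \<open>\<partial>\<Omega>\<^sub>i\<close> transversally at \<open>P\<close> (\<open>corner_barrier\<close>).

The errors therefore decay geometrically, uniformly on the disks. The skeleton \<open>S\<^sub>j\<close> lies in \<open>\<Omega>\<^sub>j\<close> up to
finitely many points, which are null for arclength, so the essential suprema decay as well. Their
maximum is nonnegative because by (A1) some skeleton has positive length; over a null set the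
essential supremum would be \<open>-\<infinity>\<close>.\<close>

section \<open>Harmonic functions and the maximum principle\<close>

lemma harmonic_on_add:
  assumes "harmonic_on u S" "harmonic_on v S"
  shows "harmonic_on (\<lambda>x. u x + v x) S"
proof -
  obtain G1 H1 where 1: "\<And>x. x\<in>S \<Longrightarrow> (u has_derivative (\<lambda>h. G1 x \<bullet> h)) (at x)"
      "\<And>x. x\<in>S \<Longrightarrow> (G1 has_derivative H1 x) (at x)"
      "\<And>b. b\<in>Basis \<Longrightarrow> continuous_on S (\<lambda>x. H1 x b)"
      "\<And>x. x\<in>S \<Longrightarrow> (\<Sum>b\<in>Basis. H1 x b \<bullet> b) = 0"
    using assms(1) unfolding harmonic_on_def by blast
  obtain G2 H2 where 2: "\<And>x. x\<in>S \<Longrightarrow> (v has_derivative (\<lambda>h. G2 x \<bullet> h)) (at x)"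
      "\<And>x. x\<in>S \<Longrightarrow> (G2 has_derivative H2 x) (at x)"
      "\<And>b. b\<in>Basis \<Longrightarrow> continuous_on S (\<lambda>x. H2 x b)"
      "\<And>x. x\<in>S \<Longrightarrow> (\<Sum>b\<in>Basis. H2 x b \<bullet> b) = 0"
    using assms(2) unfolding harmonic_on_def by blast
  show ?thesis
    unfolding harmonic_on_def
  proof (intro exI conjI ballI)
    fix x assume x: "x \<in> S"
    show "((\<lambda>x. u x + v x) has_derivative (\<lambda>h. (G1 x + G2 x) \<bullet> h)) (at x)"
      using has_derivative_add[OF 1(1)[OF x] 2(1)[OF x]] by (simp add: inner_add_left)
    show "((\<lambda>x. G1 x + G2 x) has_derivative (\<lambda>h. H1 x h + H2 x h)) (at x)"
      by (rule has_derivative_add[OF 1(2)[OF x] 2(2)[OF x]])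
    show "(\<Sum>b\<in>Basis. (H1 x b + H2 x b) \<bullet> b) = 0"
      using 1(4)[OF x] 2(4)[OF x] by (simp add: inner_add_left sum.distrib)
  qed (auto intro!: continuous_on_add 1 2)
qed

lemma harmonic_on_cmult:
  assumes "harmonic_on u S"
  shows "harmonic_on (\<lambda>x. a * u x) S"
proof -
  obtain G1 H1 where 1: "\<And>x. x\<in>S \<Longrightarrow> (u has_derivative (\<lambda>h. G1 x \<bullet> h)) (at x)"
      "\<And>x. x\<in>S \<Longrightarrow> (G1 has_derivative H1 x) (at x)"
      "\<And>b. b\<in>Basis \<Longrightarrow> continuous_on S (\<lambda>x. H1 x b)"
      "\<And>x. x\<in>S \<Longrightarrow> (\<Sum>b\<in>Basis. H1 x b \<bullet> b) = 0"
    using assms(1) unfolding harmonic_on_def by blast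
  show ?thesis
    unfolding harmonic_on_def
  proof (intro exI conjI ballI)
    fix x assume x: "x \<in> S"
    show "((\<lambda>x. a * u x) has_derivative (\<lambda>h. (a *\<^sub>R G1 x) \<bullet> h)) (at x)"
      using has_derivative_mult_right[OF 1(1)[OF x], of a] by simp
    show "((\<lambda>x. a *\<^sub>R G1 x) has_derivative (\<lambda>h. a *\<^sub>R H1 x h)) (at x)"
      by (rule has_derivative_scaleR_right[OF 1(2)[OF x]])
    show "(\<Sum>b\<in>Basis. (a *\<^sub>R H1 x b) \<bullet> b) = 0"
      using 1(4)[OF x] by (simp add: sum_distrib_left[symmetric])
  qed (auto intro!: continuous_on_scaleR continuous_on_const 1)
qed

lemma harmonic_on_diff:
  assumes "harmonic_on u S" "harmonic_on v S"
  shows "harmonic_on (\<lambda>x. u x - v x) S"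
  using harmonic_on_add[OF assms(1) harmonic_on_cmult[OF assms(2), of "-1"]] by simp

lemma harmonic_on_cong:
  assumes "harmonic_on u S" "open S" "\<And>x. x \<in> S \<Longrightarrow> u x = v x"
  shows "harmonic_on v S"
proof -
  have "(v has_derivative D) (at x)" if "x \<in> S" "(u has_derivative D) (at x)" for D x
    using has_derivative_transform_within_open[OF that(2) assms(2) that(1)] assms(3) by simp
  moreover obtain G H where "\<forall>x\<in>S. (u has_derivative (\<lambda>h. G x \<bullet> h)) (at x)"
      "\<forall>x\<in>S. (G has_derivative H x) (at x)" "\<forall>b\<in>Basis. continuous_on S (\<lambda>x. H x b)"
      "\<forall>x\<in>S. (\<Sum>b\<in>Basis. H x b \<bullet> b) = 0"
    using assms(1) unfolding harmonic_on_def by blast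
  ultimately show ?thesis
    unfolding harmonic_on_def by (intro exI[of _ G] exI[of _ H]) blast
qed

lemma harmonic_on_subset:
  assumes "harmonic_on u S" "T \<subseteq> S"
  shows "harmonic_on u T"
proof -
  obtain G H where GH: "\<forall>x\<in>S. (u has_derivative (\<lambda>h. G x \<bullet> h)) (at x)"
      "\<forall>x\<in>S. (G has_derivative H x) (at x)" "\<forall>b\<in>Basis. continuous_on S (\<lambda>x. H x b)"
      "\<forall>x\<in>S. (\<Sum>b\<in>Basis. H x b \<bullet> b) = 0"
    using assms(1) unfolding harmonic_on_def by blast
  have "\<forall>b\<in>Basis. continuous_on T (\<lambda>x. H x b)"
    using GH(3) continuous_on_subset[OF _ assms(2)] by blast
  with GH assms(2) show ?thesis
    unfolding harmonic_on_def by (intro exI[of _ G] exI[of _ H]) blast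
qed

lemma harmonic_on_imp_continuous_on:
  assumes "harmonic_on u S"
  shows "continuous_on S u"
proof -
  obtain G where "\<And>x. x\<in>S \<Longrightarrow> (u has_derivative (\<lambda>h. G x \<bullet> h)) (at x)"
    using assms unfolding harmonic_on_def by blast
  then show ?thesis
    by (intro continuous_at_imp_continuous_on ballI has_derivative_continuous)
qed

text \<open>The gradient of \<open>Re f\<close> is the conjugate of \<open>f'\<close>, so its Hessian is \<open>h \<mapsto> cnj (f'' h)\<close>, whose trace is
\<open>Re f'' - Re f'' = 0\<close>.\<close>

lemma harmonic_on_Re_holomorphic:
  assumes "f holomorphic_on S" "open S"
  shows "harmonic_on (\<lambda>z. Re (f z)) S"
  unfolding harmonic_on_def
proof (intro exI conjI ballI)
  have h1: "deriv f holomorphic_on S" and h2: "deriv (deriv f) holomorphic_on S"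
    using assms holomorphic_deriv by blast+
  fix z assume z: "z \<in> S"
  have "(f has_derivative (\<lambda>h. deriv f z * h)) (at z)"
    using holomorphic_derivI[OF assms z] by (simp add: has_field_derivative_def mult_commute_abs)
  from bounded_linear.has_derivative[OF bounded_linear_Re this]
  show "((\<lambda>z. Re (f z)) has_derivative (\<lambda>h. cnj (deriv f z) \<bullet> h)) (at z)"
    by (simp add: inner_complex_def)
  have "(deriv f has_derivative (\<lambda>h. deriv (deriv f) z * h)) (at z)"
    using holomorphic_derivI[OF h1 assms(2) z] by (simp add: has_field_derivative_def mult_commute_abs)
  from bounded_linear.has_derivative[OF bounded_linear_cnj this]
  show "((\<lambda>z. cnj (deriv f z)) has_derivative (\<lambda>h. cnj (deriv (deriv f) z * h))) (at z)" .
  show "(\<Sum>b\<in>Basis. cnj (deriv (deriv f) z * b) \<bullet> b) = 0"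
    by (simp add: Basis_complex_def inner_complex_def)
next
  fix b :: complex
  have h2: "deriv (deriv f) holomorphic_on S"
    using assms holomorphic_deriv by blast
  show "continuous_on S (\<lambda>z. cnj (deriv (deriv f) z * b))"
    by (intro continuous_intros holomorphic_on_imp_continuous_on h2)
qed

text \<open>The second derivative test: at an interior maximum every pure second derivative of \<open>u\<close> is at most
\<open>- 2 \<epsilon>\<close>, so the Laplacian of \<open>u\<close> would be negative.\<close>

lemma harmonic_plus_quadratic_no_max:
  fixes u :: "'a::euclidean_space \<Rightarrow> real"
  assumes "harmonic_on u S" "open S" "x \<in> S" "\<epsilon> > 0"
    and max: "\<And>y. y \<in> S \<Longrightarrow> u y + \<epsilon> * (y \<bullet> y) \<le> u x + \<epsilon> * (x \<bullet> x)"
  shows False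
proof -
  obtain G H where G: "\<And>x. x\<in>S \<Longrightarrow> (u has_derivative (\<lambda>h. G x \<bullet> h)) (at x)"
      and H: "\<And>x. x\<in>S \<Longrightarrow> (G has_derivative H x) (at x)"
      and tr: "\<And>x. x\<in>S \<Longrightarrow> (\<Sum>b\<in>Basis. H x b \<bullet> b) = 0"
    using assms(1) unfolding harmonic_on_def by blast
  obtain e where e: "e > 0" "ball x e \<subseteq> S" using assms(2,3) by (meson openE)
  have "H x b \<bullet> b \<le> - 2 * \<epsilon>" if b: "b \<in> Basis" for b
  proof (rule ccontr)
    assume neg: "\<not> H x b \<bullet> b \<le> - 2 * \<epsilon>"
    define f where "f = (\<lambda>t. u (x + t *\<^sub>R b) + \<epsilon> * ((x + t *\<^sub>R b) \<bullet> (x + t *\<^sub>R b)))"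
    define f' where "f' = (\<lambda>t. G (x + t *\<^sub>R b) \<bullet> b + 2 * \<epsilon> * ((x + t *\<^sub>R b) \<bullet> b))"
    have inS: "x + t *\<^sub>R b \<in> S" if "\<bar>t\<bar> < e" for t
      using that e(2) b by (auto simp: dist_norm intro!: subsetD[OF e(2)])
    have line: "((\<lambda>t. x + t *\<^sub>R b) has_derivative (\<lambda>s. s *\<^sub>R b)) (at t)" for t :: real
      by (auto intro!: derivative_eq_intros)
    have d1: "(f has_real_derivative f' t) (at t)" if "\<bar>t\<bar> < e" for t
    proof -
      have "((\<lambda>t. u (x + t *\<^sub>R b)) has_derivative (\<lambda>s. G (x + t *\<^sub>R b) \<bullet> (s *\<^sub>R b))) (at t)"
        using has_derivative_compose[OF line G[OF inS[OF that]]] by simp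
      moreover have "((\<lambda>t. \<epsilon> * ((x + t *\<^sub>R b) \<bullet> (x + t *\<^sub>R b))) has_derivative
           (\<lambda>s. 2 * \<epsilon> * ((x + t *\<^sub>R b) \<bullet> b) * s)) (at t)"
        by (auto intro!: derivative_eq_intros simp: algebra_simps inner_commute)
      ultimately have "(f has_derivative (\<lambda>s. G (x + t *\<^sub>R b) \<bullet> (s *\<^sub>R b) + 2 * \<epsilon> * ((x + t *\<^sub>R b) \<bullet> b) * s)) (at t)"
        unfolding f_def by (rule has_derivative_add)
      then show ?thesis
        unfolding has_field_derivative_def f'_def
        by (rule has_derivative_eq_rhs) (auto simp: algebra_simps)
    qed
    have "((\<lambda>t. G (x + t *\<^sub>R b)) has_derivative (\<lambda>s. H x (s *\<^sub>R b))) (at 0)"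
      using has_derivative_compose[OF line, of G "H x" 0] H[OF assms(3)] by simp
    moreover have lin: "linear (H x)" using H[OF assms(3)] has_derivative_linear by blast
    ultimately have "((\<lambda>t. G (x + t *\<^sub>R b) \<bullet> b) has_derivative (\<lambda>s. (s *\<^sub>R H x b) \<bullet> b)) (at 0)"
      by (auto intro!: derivative_eq_intros simp: linear_cmul)
    moreover have "((\<lambda>t. 2 * \<epsilon> * ((x + t *\<^sub>R b) \<bullet> b)) has_derivative (\<lambda>s. 2 * \<epsilon> * s)) (at 0)"
      using b by (auto intro!: derivative_eq_intros simp: algebra_simps)
    ultimately have "(f' has_derivative (\<lambda>s. (s *\<^sub>R H x b) \<bullet> b + 2 * \<epsilon> * s)) (at 0)"
      unfolding f'_def by (rule has_derivative_add)
    then have d2: "(f' has_real_derivative (H x b \<bullet> b + 2 * \<epsilon>)) (at 0)"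
      unfolding has_field_derivative_def by (rule has_derivative_eq_rhs) (auto simp: algebra_simps)
    have "f t \<le> f 0" if "\<bar>t\<bar> < e" for t
      using max[OF inS[OF that]] by (simp add: f_def)
    then have "f' 0 = 0"
      using DERIV_local_max[OF d1[of 0] \<open>e > 0\<close>] e(1) by simp
    then obtain d where d: "d > 0" "\<And>h. 0 < h \<Longrightarrow> h < d \<Longrightarrow> f' h > 0"
      using DERIV_pos_inc_right[OF d2] neg by force
    define s where "s = min d e / 2"
    have s: "0 < s" "s < d" "s < e" using d(1) e(1) by (auto simp: s_def)
    have "f 0 < f s"
    proof (rule DERIV_pos_imp_increasing_open[OF s(1)])
      show "\<exists>y. (f has_real_derivative y) (at t) \<and> y > 0" if "0 < t" "t < s" for t
        using that s d1[of t] d(2)[of t] by auto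
      show "continuous_on {0..s} f"
        using s by (intro continuous_at_imp_continuous_on ballI DERIV_isCont[OF d1]) auto
    qed
    moreover have "f s \<le> f 0"
      using max[OF inS[of s]] s by (simp add: f_def)
    ultimately show False by simp
  qed
  then have "(\<Sum>b\<in>Basis. H x b \<bullet> b) \<le> (\<Sum>b\<in>(Basis::'a set). - 2 * \<epsilon>)"
    by (intro sum_mono)
  also have "\<dots> < 0" using assms(4) by simp
  finally show False using tr[OF assms(3)] by simp
qed

text \<open>A value \<open>u x > 0\<close> survives the perturbation \<open>V = u + \<epsilon> (|z|\<^sup>2 - B\<^sup>2) \<le> u\<close> for small \<open>\<epsilon>\<close>. The boundary condition makes
the superlevel set of \<open>V\<close> compact in \<open>S\<close>, so \<open>V\<close> attains its maximum.\<close>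

lemma harmonic_max_principle:
  fixes u :: "'a::euclidean_space \<Rightarrow> real"
  assumes u: "harmonic_on u S" and S: "open S" "bounded S"
    and bd: "\<And>y \<epsilon>. y \<in> frontier S \<Longrightarrow> \<epsilon> > 0 \<Longrightarrow> \<forall>\<^sub>F z in at y within S. u z < \<epsilon>"
    and x: "x \<in> S"
  shows "u x \<le> 0"
proof (rule ccontr)
  assume "\<not> u x \<le> 0"
  then have ux: "u x > 0" by simp
  obtain B where B: "B > 0" "\<And>z. z \<in> S \<Longrightarrow> norm z \<le> B"
    using S(2) bounded_pos by metis
  define \<epsilon> where "\<epsilon> = u x / (2 * B\<^sup>2)"
  have \<epsilon>: "\<epsilon> > 0" using ux B(1) by (simp add: \<epsilon>_def)
  define V where "V = (\<lambda>z. u z + \<epsilon> * (z \<bullet> z) - \<epsilon> * B\<^sup>2)"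
  have Vu: "V z \<le> u z" if "z \<in> S" for z
    using B(2)[OF that] \<epsilon> by (simp add: V_def power2_norm_eq_inner[symmetric] power_mono)
  define m where "m = V x"
  have "\<epsilon> * B\<^sup>2 = u x / 2" using B(1) by (simp add: \<epsilon>_def)
  moreover have "0 \<le> \<epsilon> * (x \<bullet> x)" using \<epsilon> by simp
  ultimately have m: "m > 0" using ux unfolding m_def V_def by linarith
  have contV: "continuous_on S V"
    unfolding V_def by (intro continuous_intros harmonic_on_imp_continuous_on u)
  define T where "T = {z \<in> S. m \<le> V z}"
  have "closed T"
    unfolding closed_sequential_limits
  proof (intro allI impI, elim conjE)
    fix s l assume s: "\<forall>n. s n \<in> T" "s \<longlonglongrightarrow> l"
    have sS: "\<And>n. s n \<in> S" "\<And>n. m \<le> V (s n)" using s(1) by (auto simp: T_def)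
    have lcl: "l \<in> closure S" using closure_sequential sS(1) s(2) by blast
    show "l \<in> T"
    proof (cases "l \<in> S")
      case True
      then have "(\<lambda>n. V (s n)) \<longlonglongrightarrow> V l"
        using contV sS(1) s(2) by (simp add: continuous_on_sequentially comp_def)
      then have "m \<le> V l" using sS(2) LIMSEQ_le_const by blast
      then show ?thesis using True by (simp add: T_def)
    next
      case False
      then have "l \<in> frontier S" using lcl S(1) by (simp add: frontier_def interior_open)
      moreover have "filterlim s (at l within S) sequentially"
        unfolding filterlim_at using s(2) sS(1) False by (auto intro!: always_eventually)
      ultimately have "\<forall>\<^sub>F n in sequentially. u (s n) < m"
        using filterlim_iff[THEN iffD1, rule_format] bd[OF _ m] by blast
      then obtain n where "u (s n) < m" by (auto simp: eventually_sequentially)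
      then show ?thesis using Vu[OF sS(1)] sS(2) by (meson not_le order_trans)
    qed
  qed
  moreover have "bounded T" by (rule bounded_subset[OF S(2)]) (auto simp: T_def)
  ultimately have "compact T" by (simp add: compact_eq_bounded_closed)
  moreover have "x \<in> T" using x by (simp add: T_def m_def)
  moreover have "continuous_on T V" by (rule continuous_on_subset[OF contV]) (auto simp: T_def)
  ultimately obtain y where y: "y \<in> T" "\<And>z. z \<in> T \<Longrightarrow> V z \<le> V y"
    using continuous_attains_sup[of T V] by blast
  have "V z \<le> V y" if "z \<in> S" for z
    using y that unfolding T_def by (cases "m \<le> V z") auto
  then have "\<And>z. z \<in> S \<Longrightarrow> u z + \<epsilon> * (z \<bullet> z) \<le> u y + \<epsilon> * (y \<bullet> y)" unfolding V_def by auto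
  then show False
    using harmonic_plus_quadratic_no_max[OF u S(1) _ \<epsilon>, of y] y(1) unfolding T_def by blast
qed

lemma holomorphic_on_Ln_halfplane:
  assumes "f holomorphic_on S" "\<And>z. z \<in> S \<Longrightarrow> Re (f z) > 0"
  shows "(\<lambda>z. Ln (f z)) holomorphic_on S"
proof (rule holomorphic_on_Ln'[OF _ assms(1)])
  fix z assume "z \<in> S"
  then show "f z \<notin> \<real>\<^sub>\<le>\<^sub>0" using assms(2)[of z] by (simp add: complex_nonpos_Reals_iff)
qed

lemma harmonic_on_sum:
  fixes u :: "'i \<Rightarrow> 'a::euclidean_space \<Rightarrow> real"
  assumes "finite I" "\<And>i. i \<in> I \<Longrightarrow> harmonic_on (u i) S"
  shows "harmonic_on (\<lambda>x. \<Sum>i\<in>I. u i x) S"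
  using assms
proof (induction rule: finite_induct)
  case empty
  have "((\<lambda>x::'a. 0) has_derivative (\<bullet>) (0::'a)) (at x)" for x
    using has_derivative_const[of "0::real" "at x"] by (rule has_derivative_eq_rhs) (simp add: fun_eq_iff)
  then have "harmonic_on (\<lambda>x::'a. 0) S"
    unfolding harmonic_on_def
    by (intro exI[of _ "\<lambda>_. 0"] exI[of _ "\<lambda>_ _. 0"] conjI ballI) auto
  then show ?case by simp
next
  case (insert i I)
  then show ?case using harmonic_on_add[of "u i" S "\<lambda>x. \<Sum>i\<in>I. u i x"] by simp
qed

text \<open>Finitely many boundary points are negligible for bounded functions: for \<open>p\<close> on the circle the
function \<open>ln (|p - z| / r)\<close> is harmonic, bounded above and tends to \<open>-\<infinity>\<close> at \<open>p\<close>, so an arbitrarily small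
multiple of it outweighs \<open>u\<close> near \<open>p\<close>.\<close>

lemma bounded_harmonic_max_principle_ball:
  fixes c :: complex
  assumes u: "harmonic_on u (ball c r)" and bdd: "bounded (u ` ball c r)" and F: "finite F"
    and bd: "\<And>y. y \<in> frontier (ball c r) - F \<Longrightarrow> \<exists>l\<le>0. (u \<longlongrightarrow> l) (at y within ball c r)"
    and x: "x \<in> ball c r"
  shows "u x \<le> 0"
proof -
  have r: "r > 0" using x by (metis ball_eq_empty empty_iff linorder_not_less)
  define F' where "F' = F \<inter> frontier (ball c r)"
  have F': "finite F'" and Fr: "\<And>p. p \<in> F' \<Longrightarrow> dist c p = r"
    using F r by (auto simp: F'_def sphere_def)
  define h where "h = (\<lambda>p z. Re (Ln ((p - z) / (p - c))))"
  have pos: "Re ((p - z) / (p - c)) > 0" if "p \<in> F'" "z \<in> ball c r" for p z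
  proof -
    have n: "norm (p - c) = r" using Fr[OF that(1)] by (simp add: dist_norm norm_minus_commute)
    then have "p - c \<noteq> 0" using r by auto
    then have "(p - z) / (p - c) = 1 - (z - c) / (p - c)" by (simp add: field_simps)
    moreover have "norm ((z - c) / (p - c)) < 1"
      using that(2) n r by (simp add: norm_divide dist_norm norm_minus_commute)
    then have "Re ((z - c) / (p - c)) < 1" using complex_Re_le_cmod order_le_less_trans by blast
    ultimately show ?thesis by simp
  qed
  have hharm: "harmonic_on (h p) (ball c r)" if "p \<in> F'" for p
  proof -
    have "p - c \<noteq> 0" using Fr[OF that] r by auto
    then show ?thesis
    unfolding h_def
    by (intro harmonic_on_Re_holomorphic holomorphic_on_Ln_halfplane holomorphic_intros pos that) auto
  qed
  have hval: "h p z = ln (norm (p - z) / r)" if "p \<in> F'" "z \<in> ball c r" for p z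
  proof -
    have "(p - z) / (p - c) \<noteq> 0" using pos[OF that] by force
    then show ?thesis
      using Fr[OF that(1)] by (simp add: h_def norm_divide dist_norm norm_minus_commute)
  qed
  have hle: "h p z \<le> ln 2" if "p \<in> F'" "z \<in> ball c r" for p z
  proof -
    have "norm (p - z) \<le> 2 * r" using dist_triangle[of p z c] that(2) Fr[OF that(1)]
      by (simp add: dist_norm norm_minus_commute)
    moreover have "norm (p - z) > 0" using pos[OF that] by force
    ultimately show ?thesis
      unfolding hval[OF that] using r by (intro ln_mono) (auto simp: field_simps)
  qed
  define h\<^sub>0 where "h\<^sub>0 = (\<lambda>z. \<Sum>p\<in>F'. h p z - ln 2)"
  have h0: "harmonic_on h\<^sub>0 (ball c r)"
  proof -
    have "harmonic_on (\<lambda>z. h p z - ln 2) (ball c r)" if "p \<in> F'" for p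
      using harmonic_on_diff[OF hharm[OF that] harmonic_on_Re_holomorphic[of "\<lambda>_. complex_of_real (ln 2)"]]
      by simp
    then show ?thesis unfolding h\<^sub>0_def by (intro harmonic_on_sum F')
  qed
  obtain M where M: "M > 0" "\<And>z. z \<in> ball c r \<Longrightarrow> u z \<le> M"
    using bdd unfolding bounded_pos by (auto simp: abs_le_iff)
  have h0le: "h\<^sub>0 z \<le> h p z - ln 2" "h\<^sub>0 z \<le> 0" if "p \<in> F'" "z \<in> ball c r" for p z
  proof -
    have "(\<Sum>q\<in>F' - {p}. h q z - ln 2) \<le> 0" using hle that(2) by (intro sum_nonpos) auto
    then show "h\<^sub>0 z \<le> h p z - ln 2" unfolding h\<^sub>0_def using F' that(1) by (simp add: sum.remove[of F' p])
    then show "h\<^sub>0 z \<le> 0" using hle[OF that] by linarith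
  qed
  have h0np: "h\<^sub>0 z \<le> 0" if "z \<in> ball c r" for z
    unfolding h\<^sub>0_def using hle that by (intro sum_nonpos) auto
  have key: "u x + \<epsilon> * h\<^sub>0 x \<le> 0" if \<epsilon>: "\<epsilon> > 0" for \<epsilon>
  proof (rule harmonic_max_principle[where S = "ball c r" and u = "\<lambda>z. u z + \<epsilon> * h\<^sub>0 z"])
    show "harmonic_on (\<lambda>z. u z + \<epsilon> * h\<^sub>0 z) (ball c r)"
      by (intro harmonic_on_add harmonic_on_cmult u h0)
    fix y and \<delta> :: real assume y: "y \<in> frontier (ball c r)" and \<delta>: "\<delta> > 0"
    have inb: "\<forall>\<^sub>F z in at y within ball c r. z \<in> ball c r"
      by (simp add: eventually_at_filter)
    show "\<forall>\<^sub>F z in at y within ball c r. u z + \<epsilon> * h\<^sub>0 z < \<delta>"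
    proof (cases "y \<in> F")
      case False
      then obtain l where l: "l \<le> 0" "(u \<longlongrightarrow> l) (at y within ball c r)" using bd y by blast
      then have "\<forall>\<^sub>F z in at y within ball c r. u z < \<delta>"
        using \<delta> by (intro order_tendstoD(2)[OF l(2)]) auto
      then show ?thesis using inb
        by eventually_elim (use h0np \<epsilon> mult_nonneg_nonpos[of \<epsilon>] in fastforce)
    next
      case True
      then have y': "y \<in> F'" using y by (simp add: F'_def)
      define \<rho> where "\<rho> = r * exp (- M / \<epsilon>)"
      have "\<rho> > 0" using r by (simp add: \<rho>_def)
      then have "\<forall>\<^sub>F z in at y within ball c r. dist z y < \<rho>"
        by (auto simp: eventually_at)
      then show ?thesis using inb
      proof eventually_elim
        case (elim z)
        have "norm (y - z) > 0" using pos[OF y' elim(2)] by force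
        then have "h y z \<le> ln (exp (- M / \<epsilon>))"
          unfolding hval[OF y' elim(2)] using elim r
          by (intro ln_mono) (auto simp: \<rho>_def field_simps dist_norm norm_minus_commute)
        then have "h\<^sub>0 z \<le> - M / \<epsilon> - ln 2" using h0le(1)[OF y' elim(2)] by simp
        then have "h\<^sub>0 z \<le> - M / \<epsilon>" using ln_gt_zero[of "2::real"] by linarith
        then have "\<epsilon> * h\<^sub>0 z \<le> - M" using \<epsilon> by (simp add: field_simps)
        then show ?case using M(2)[OF elim(2)] \<delta> by linarith
      qed
    qed
  qed (use x in auto)
  have "u x \<le> \<delta>" if \<delta>: "\<delta> > 0" for \<delta>
  proof -
    define \<epsilon> where "\<epsilon> = \<delta> / (1 - h\<^sub>0 x)"
    have d: "1 - h\<^sub>0 x > 0" using h0np[OF x] by linarith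
    then have "\<epsilon> > 0" using \<delta> by (simp add: \<epsilon>_def)
    have "\<epsilon> * (1 - h\<^sub>0 x) = \<delta>" using d by (simp add: \<epsilon>_def)
    then show ?thesis using key[OF \<open>\<epsilon> > 0\<close>] \<open>\<epsilon> > 0\<close> by (simp add: algebra_simps)
  qed
  then show ?thesis using field_le_epsilon[of "u x" 0] by simp
qed

section \<open>Two circles through a common point\<close>

text \<open>The coordinate \<open>\<zeta> = (z - P) / (a - P)\<close> puts the circle about \<open>a\<close> through \<open>P\<close> into the position
\<open>|\<zeta> - 1| = 1\<close>, with tangent \<open>\<i> \<real>\<close> at \<open>P\<close>; every other circle through \<open>P\<close> is then given by
\<open>|\<zeta>|\<^sup>2 = 2 Re (\<zeta> cnj \<omega>)\<close>, where \<open>\<omega>\<close> is the coordinate of its centre.\<close>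

lemma power_of_point_quotient:
  fixes a b P z :: complex
  assumes "a \<noteq> P" "dist b P = s"
  defines "\<zeta> \<equiv> (z - P) / (a - P)" and "\<omega> \<equiv> (b - P) / (a - P)"
  shows "(dist b z)\<^sup>2 - s\<^sup>2 = (norm (a - P))\<^sup>2 * ((norm \<zeta>)\<^sup>2 - 2 * Re (\<zeta> * cnj \<omega>))"
proof -
  have eq: "z - P = (a - P) * \<zeta>" "b - P = (a - P) * \<omega>" using assms(1) by (auto simp: \<zeta>_def \<omega>_def)
  have "(a - P) * (\<omega> - \<zeta>) = b - z" unfolding right_diff_distrib eq[symmetric] by simp
  then have "dist b z = norm ((a - P) * (\<omega> - \<zeta>))" by (simp add: dist_norm)
  moreover have "s = norm ((a - P) * \<omega>)" using eq assms(2) by (simp add: dist_norm)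
  moreover have "(norm (\<omega> - \<zeta>))\<^sup>2 - (norm \<omega>)\<^sup>2 = (norm \<zeta>)\<^sup>2 - 2 * Re (\<zeta> * cnj \<omega>)"
    unfolding cmod_power2 by (simp add: power2_eq_square algebra_simps)
  ultimately show ?thesis
    by (simp add: norm_mult power_mult_distrib right_diff_distrib[symmetric])
qed

lemma ball_sphere_cball_quotient:
  fixes a b P z :: complex
  assumes "a \<noteq> P" "dist b P = s"
  defines "\<zeta> \<equiv> (z - P) / (a - P)" and "\<omega> \<equiv> (b - P) / (a - P)"
  shows "z \<in> ball b s \<longleftrightarrow> (norm \<zeta>)\<^sup>2 < 2 * Re (\<zeta> * cnj \<omega>)"
    and "z \<in> sphere b s \<longleftrightarrow> (norm \<zeta>)\<^sup>2 = 2 * Re (\<zeta> * cnj \<omega>)"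
    and "z \<in> cball b s \<longleftrightarrow> (norm \<zeta>)\<^sup>2 \<le> 2 * Re (\<zeta> * cnj \<omega>)"
proof -
  have s: "s \<ge> 0" using assms(2) by auto
  have n: "(norm (a - P))\<^sup>2 > 0" using assms(1) by simp
  note e = power_of_point_quotient[OF assms(1,2), of z, folded \<zeta>_def \<omega>_def]
  have "z \<in> ball b s \<longleftrightarrow> (dist b z)\<^sup>2 - s\<^sup>2 < 0"
    using s abs_le_square_iff[of s "dist b z"] by (simp add: not_le[symmetric])
  then show "z \<in> ball b s \<longleftrightarrow> (norm \<zeta>)\<^sup>2 < 2 * Re (\<zeta> * cnj \<omega>)"
    unfolding e using n by (simp add: mult_less_0_iff)
  have "z \<in> sphere b s \<longleftrightarrow> (dist b z)\<^sup>2 - s\<^sup>2 = 0" using s by (simp add: power2_eq_iff_nonneg)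
  then show "z \<in> sphere b s \<longleftrightarrow> (norm \<zeta>)\<^sup>2 = 2 * Re (\<zeta> * cnj \<omega>)"
    unfolding e using n by simp
  have "z \<in> cball b s \<longleftrightarrow> (dist b z)\<^sup>2 - s\<^sup>2 \<le> 0"
    using s abs_le_square_iff[of "dist b z" s] by simp
  then show "z \<in> cball b s \<longleftrightarrow> (norm \<zeta>)\<^sup>2 \<le> 2 * Re (\<zeta> * cnj \<omega>)"
    unfolding e using n by (simp add: mult_le_0_iff)
qed

lemma ball_sphere_quotient_self:
  fixes a P z :: complex
  assumes "a \<noteq> P" "dist a P = r"
  defines "\<zeta> \<equiv> (z - P) / (a - P)"
  shows "z \<in> ball a r \<longleftrightarrow> (norm \<zeta>)\<^sup>2 < 2 * Re \<zeta>"
    and "z \<in> sphere a r \<longleftrightarrow> (norm \<zeta>)\<^sup>2 = 2 * Re \<zeta>"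
  using ball_sphere_cball_quotient[OF assms(1,2), of z] assms(1) by (auto simp: \<zeta>_def)

text \<open>If \<open>\<omega> = (b - P) / (a - P)\<close> is real, the circles are tangent at \<open>P\<close>, and then the disks are disjoint
or nested: a point of the first circle in the second disk forces \<open>\<omega> > 1\<close>, and a point of the second
circle in the first disk forces \<open>\<omega> < 1\<close>.\<close>

lemma circles_transversal:
  fixes a b P :: complex
  assumes P: "P \<in> sphere a r" "P \<in> sphere b s" and pos: "r > 0"
    and out: "sphere a r \<inter> ball b s \<noteq> {}" "sphere b s \<inter> ball a r \<noteq> {}"
  shows "Im ((b - P) / (a - P)) \<noteq> 0"
proof
  assume im: "Im ((b - P) / (a - P)) = 0"
  have aP: "a \<noteq> P" "dist a P = r" "dist b P = s" using P pos by auto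
  define t where "t = Re ((b - P) / (a - P))"
  have \<omega>: "(b - P) / (a - P) = of_real t" using im by (simp add: t_def complex_eq_iff)
  let ?\<zeta> = "\<lambda>z. (z - P) / (a - P)"
  have A: "z \<in> ball a r \<longleftrightarrow> (norm (?\<zeta> z))\<^sup>2 < 2 * Re (?\<zeta> z)"
    "z \<in> sphere a r \<longleftrightarrow> (norm (?\<zeta> z))\<^sup>2 = 2 * Re (?\<zeta> z)" for z
    using ball_sphere_quotient_self[OF aP(1,2)] by auto
  have R: "Re (w * cnj (of_real t)) = Re w * t" for w by simp
  have B: "z \<in> ball b s \<longleftrightarrow> (norm (?\<zeta> z))\<^sup>2 < 2 * (Re (?\<zeta> z) * t)"
    "z \<in> sphere b s \<longleftrightarrow> (norm (?\<zeta> z))\<^sup>2 = 2 * (Re (?\<zeta> z) * t)" for z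
    using ball_sphere_cball_quotient(1,2)[OF aP(1,3), of z] unfolding \<omega> R by auto
  obtain z1 where "z1 \<in> sphere a r" "z1 \<in> ball b s" using out by blast
  then have 1: "2 * Re (?\<zeta> z1) < 2 * (Re (?\<zeta> z1) * t)" "Re (?\<zeta> z1) \<ge> 0"
    using A[of z1] B[of z1] zero_le_power2[of "norm (?\<zeta> z1)"] by auto
  then have "Re (?\<zeta> z1) > 0" by (cases "Re (?\<zeta> z1) = 0") auto
  then have t1: "t > 1" using 1(1) mult_le_cancel_left1 by fastforce
  obtain z2 where "z2 \<in> sphere b s" "z2 \<in> ball a r" using out by blast
  then have 2: "2 * (Re (?\<zeta> z2) * t) < 2 * Re (?\<zeta> z2)" "Re (?\<zeta> z2) > 0"
  proof -
    have "0 \<le> (norm (?\<zeta> z2))\<^sup>2" by simp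
    with A(1)[of z2] B(2)[of z2] \<open>z2 \<in> sphere b s\<close> \<open>z2 \<in> ball a r\<close>
    show "2 * (Re (?\<zeta> z2) * t) < 2 * Re (?\<zeta> z2)" "Re (?\<zeta> z2) > 0" by linarith+
  qed
  then have "t < 1" by (simp add: mult_less_cancel_left2)
  with t1 show False by simp
qed

text \<open>On the circle \<open>|\<zeta>|\<^sup>2 = 2 Re \<zeta>\<close> near \<open>0\<close> the real part of \<open>\<zeta>\<close> is of second order in the imaginary part.
Membership in the other disk is thus decided by the sign of the first-order term \<open>Im \<zeta> Im \<omega>\<close>, that
is, by the side of \<open>P\<close> on which the point lies.\<close>

lemma circles_cross_locally:
  fixes a b P :: complex
  assumes P: "P \<in> sphere a r" "P \<in> sphere b s" and pos: "r > 0"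
    and tr: "Im ((b - P) / (a - P)) \<noteq> 0"
  shows "\<exists>\<rho>>0. \<forall>y\<in>sphere a r. y \<noteq> P \<longrightarrow> dist y P < \<rho> \<longrightarrow>
    (Im ((y - P) / (a - P)) * Im ((b - P) / (a - P)) > 0 \<and> y \<in> ball b s) \<or>
    (Im ((y - P) / (a - P)) * Im ((b - P) / (a - P)) < 0 \<and> y \<notin> cball b s)"
proof -
  have aP: "a \<noteq> P" "dist a P = r" "dist b P = s" using P pos by auto
  define p q where "p = Re ((b - P) / (a - P))" and "q = Im ((b - P) / (a - P))"
  have q: "\<bar>q\<bar> > 0" using tr by (simp add: q_def)
  define \<rho> where "\<rho> = min 1 (\<bar>q\<bar> / (1 + \<bar>1 - p\<bar>))"
  have d: "1 + \<bar>1 - p\<bar> > 0" by linarith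
  have \<rho>: "\<rho> > 0" "\<rho> \<le> 1" using q d by (auto simp: \<rho>_def)
  have "\<rho> \<le> \<bar>q\<bar> / (1 + \<bar>1 - p\<bar>)" by (simp add: \<rho>_def)
  then have \<rho>q: "\<rho> * (1 + \<bar>1 - p\<bar>) \<le> \<bar>q\<bar>" using d pos_le_divide_eq by blast
  show ?thesis
  proof (intro exI[of _ "r * \<rho>"] conjI ballI impI)
    show "0 < r * \<rho>" using pos \<rho> by simp
    fix y assume y: "y \<in> sphere a r" "y \<noteq> P" "dist y P < r * \<rho>"
    define \<zeta> where "\<zeta> = (y - P) / (a - P)"
    define x t where "x = Re \<zeta>" and "t = Im \<zeta>"
    have n2: "(norm \<zeta>)\<^sup>2 = x\<^sup>2 + t\<^sup>2" by (simp add: cmod_power2 x_def t_def)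
    have circ: "x\<^sup>2 + t\<^sup>2 = 2 * x"
      using ball_sphere_quotient_self(2)[OF aP(1,2), of y] y(1) n2 by (simp add: \<zeta>_def x_def)
    have n\<rho>: "norm \<zeta> < \<rho>"
      using y(3) aP pos by (simp add: \<zeta>_def norm_divide dist_norm field_simps norm_minus_commute)
    then have x1: "\<bar>x\<bar> < 1" and t\<rho>: "\<bar>t\<bar> < \<rho>"
      using abs_Re_le_cmod[of \<zeta>] abs_Im_le_cmod[of \<zeta>] \<rho>(2) by (auto simp: x_def t_def)
    have x0: "0 \<le> x" using circ zero_le_power2[of x] zero_le_power2[of t] by linarith
    have "x\<^sup>2 \<le> x" using x1 x0 by (simp add: power2_eq_square mult_left_le)
    then have xt: "x \<le> t\<^sup>2" using circ by linarith
    have t0: "t \<noteq> 0"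
    proof
      assume "t = 0"
      then have "\<zeta> = 0" using xt x0 by (simp add: complex_eq_iff x_def t_def)
      then show False using y(2) aP(1) by (simp add: \<zeta>_def)
    qed
    have "\<bar>x * (1 - p)\<bar> \<le> t\<^sup>2 * \<bar>1 - p\<bar>"
      using xt x0 by (simp add: abs_mult mult_right_mono)
    also have "\<dots> = \<bar>t\<bar> * (\<bar>t\<bar> * \<bar>1 - p\<bar>)" by (simp add: power2_eq_square)
    also have "\<dots> < \<bar>t\<bar> * \<bar>q\<bar>"
    proof (rule mult_strict_left_mono)
      have "\<bar>t\<bar> * \<bar>1 - p\<bar> \<le> \<rho> * \<bar>1 - p\<bar>" using t\<rho> by (intro mult_right_mono) auto
      also have "\<dots> < \<bar>q\<bar>" using \<rho>(1) \<rho>q by (simp add: distrib_left)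
      finally show "\<bar>t\<bar> * \<bar>1 - p\<bar> < \<bar>q\<bar>" .
    qed (use t0 in simp)
    finally have small: "\<bar>x * (1 - p)\<bar> < \<bar>t * q\<bar>" by (simp add: abs_mult)
    have R: "Re (\<zeta> * cnj w) = x * Re w + t * Im w" for w by (simp add: x_def t_def)
    have Re: "Re (\<zeta> * cnj ((b - P) / (a - P))) = x * p + t * q"
      unfolding R p_def q_def ..
    have b: "y \<in> ball b s \<longleftrightarrow> x * (1 - p) < t * q" "y \<in> cball b s \<longleftrightarrow> x * (1 - p) \<le> t * q"
      using ball_sphere_cball_quotient(1,3)[OF aP(1,3), of y, folded \<zeta>_def] n2 circ Re
      by (auto simp: algebra_simps)
    show "(Im ((y - P) / (a - P)) * Im ((b - P) / (a - P)) > 0 \<and> y \<in> ball b s) \<or>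
      (Im ((y - P) / (a - P)) * Im ((b - P) / (a - P)) < 0 \<and> y \<notin> cball b s)"
      unfolding \<zeta>_def[symmetric] q_def[symmetric] t_def[symmetric] b
      using small by linarith
  qed
qed

lemma sphere_leaves_ball_nearby:
  fixes a b P :: complex
  assumes P: "P \<in> sphere a r" "P \<in> sphere b s" and pos: "r > 0"
    and tr: "Im ((b - P) / (a - P)) \<noteq> 0" and "\<epsilon> > 0"
  shows "\<exists>y\<in>sphere a r. y \<notin> cball b s \<and> dist y P < \<epsilon>"
proof -
  have aP: "a \<noteq> P" "dist a P = r" "dist b P = s" using P pos by auto
  define q where "q = Im ((b - P) / (a - P))"
  obtain \<rho> where \<rho>: "\<rho> > 0" "\<And>y. y \<in> sphere a r \<Longrightarrow> y \<noteq> P \<Longrightarrow> dist y P < \<rho> \<Longrightarrow>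
    (Im ((y - P) / (a - P)) * q > 0 \<and> y \<in> ball b s) \<or> (Im ((y - P) / (a - P)) * q < 0 \<and> y \<notin> cball b s)"
    using circles_cross_locally[OF assms(1-4)] unfolding q_def by blast
  define \<tau> where "\<tau> = min 1 (min \<epsilon> \<rho> / (2 * r))"
  have \<tau>: "0 < \<tau>" "\<tau> \<le> 1" "r * \<tau> < \<epsilon>" "r * \<tau> < \<rho>"
  proof -
    show "0 < \<tau>" "\<tau> \<le> 1" using \<rho>(1) assms(5) pos by (auto simp: \<tau>_def)
    have "r * \<tau> \<le> r * (min \<epsilon> \<rho> / (2 * r))" using pos by (intro mult_left_mono) (auto simp: \<tau>_def)
    also have "\<dots> = min \<epsilon> \<rho> / 2" using pos by simp
    also have "\<dots> < min \<epsilon> \<rho>" using \<rho>(1) assms(5) by (simp add: min_def)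
    finally show "r * \<tau> < \<epsilon>" "r * \<tau> < \<rho>" by auto
  qed
  \<comment> \<open>The arc parameter is small and its sign selects the side of \<open>P\<close> outside the other disk.\<close>
  define \<zeta> where "\<zeta> = 1 - cis (sgn q * \<tau>)"
  define y where "y = P + (a - P) * \<zeta>"
  have y\<zeta>: "(y - P) / (a - P) = \<zeta>" using aP(1) by (simp add: y_def)
  have "(norm \<zeta>)\<^sup>2 = 2 * Re \<zeta>"
    using sin_cos_squared_add[of "sgn q * \<tau>"]
    unfolding cmod_power2 by (simp add: \<zeta>_def power2_eq_square algebra_simps)
  then have ys: "y \<in> sphere a r" using ball_sphere_quotient_self(2)[OF aP(1,2), of y] y\<zeta> by simp
  have "q \<noteq> 0" using tr by (simp add: q_def)
  then have sg: "sgn q = 1 \<or> sgn q = -1" by (auto simp: sgn_if)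
  have "norm \<zeta> = norm (exp (\<i> * of_real (sgn q * \<tau>)) - 1)"
    unfolding \<zeta>_def cis_conv_exp by (rule norm_minus_commute)
  also have "\<dots> = 2 * \<bar>sin (sgn q * \<tau> / 2)\<bar>" by (rule dist_exp_i_1)
  also have "\<dots> \<le> \<tau>" using abs_sin_x_le_abs_x[of "sgn q * \<tau> / 2"] sg \<tau>(1) by (elim disjE) simp_all
  finally have "dist y P \<le> r * \<tau>"
    using aP pos by (simp add: y_def dist_norm norm_mult norm_minus_commute)
  then have d: "dist y P < \<epsilon>" "dist y P < \<rho>" using \<tau> by auto
  have "sin \<tau> > 0" using \<tau> pi_gt3 by (intro sin_gt_zero) auto
  then have im: "Im \<zeta> * q < 0" using sg \<open>q \<noteq> 0\<close>
    by (auto simp: \<zeta>_def sgn_if split: if_splits intro: mult_pos_neg)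
  then have "y \<noteq> P" using y\<zeta> by auto
  then show ?thesis using \<rho>(2)[OF ys _ d(2)] im ys d(1) y\<zeta> by (intro bexI[of _ y]) auto
qed

text \<open>A transversal circle approaches \<open>P\<close> inside a cone about the normal of the first circle: this is what
keeps the argument of \<open>\<zeta>\<close> away from the values it takes on the first circle near \<open>P\<close>.\<close>

lemma crossing_circle_cone:
  fixes a b P y :: complex
  assumes P: "P \<in> sphere a r" "P \<in> sphere b s" and pos: "r > 0"
    and tr: "Im ((b - P) / (a - P)) \<noteq> 0"
    and y: "y \<in> sphere b s" "y \<in> ball a r"
  shows "\<bar>Im ((y - P) / (a - P))\<bar> \<le>
    (1 + \<bar>Re ((b - P) / (a - P))\<bar>) / \<bar>Im ((b - P) / (a - P))\<bar> * Re ((y - P) / (a - P))"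
proof -
  have aP: "a \<noteq> P" "dist a P = r" "dist b P = s" using P pos by auto
  define p q where "p = Re ((b - P) / (a - P))" and "q = Im ((b - P) / (a - P))"
  define \<zeta> where "\<zeta> = (y - P) / (a - P)"
  have 1: "(norm \<zeta>)\<^sup>2 < 2 * Re \<zeta>"
    using ball_sphere_quotient_self(1)[OF aP(1,2), of y] y(2) by (simp add: \<zeta>_def)
  have R: "Re (\<zeta> * cnj w) = Re \<zeta> * Re w + Im \<zeta> * Im w" for w by simp
  have "(norm \<zeta>)\<^sup>2 = 2 * (Re \<zeta> * p + Im \<zeta> * q)"
    using ball_sphere_cball_quotient(2)[OF aP(1,3), of y] y(1)
    unfolding \<zeta>_def[symmetric] R p_def[symmetric] q_def[symmetric] by blast
  then have "Im \<zeta> * q = (norm \<zeta>)\<^sup>2 / 2 - Re \<zeta> * p" by argo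
  then have "\<bar>Im \<zeta> * q\<bar> = \<bar>(norm \<zeta>)\<^sup>2 / 2 - Re \<zeta> * p\<bar>" by simp
  also have "\<dots> \<le> Re \<zeta> + Re \<zeta> * \<bar>p\<bar>"
    using 1 abs_triangle_ineq4[of "(norm \<zeta>)\<^sup>2 / 2" "Re \<zeta> * p"] zero_le_power2[of "norm \<zeta>"]
    by (simp add: abs_mult)
  finally have "\<bar>Im \<zeta>\<bar> * \<bar>q\<bar> \<le> (1 + \<bar>p\<bar>) * Re \<zeta>" by (simp add: abs_mult algebra_simps)
  then show ?thesis
    using tr unfolding p_def[symmetric] q_def[symmetric] \<zeta>_def[symmetric]
    by (simp add: field_simps)
qed

lemma finite_crossing_circles:
  fixes a b :: complex
  assumes pos: "r > 0"
    and tr: "\<And>P. P \<in> sphere a r \<Longrightarrow> P \<in> sphere b s \<Longrightarrow> Im ((b - P) / (a - P)) \<noteq> 0"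
  shows "finite (sphere a r \<inter> sphere b s)"
proof -
  let ?S = "sphere a r \<inter> sphere b s"
  have "\<not> P islimpt ?S" if "P \<in> ?S" for P
  proof -
    have P: "P \<in> sphere a r" "P \<in> sphere b s" using that by auto
    from circles_cross_locally[OF P pos tr[OF P]]
    obtain \<rho> where \<rho>: "\<rho> > 0" and cr: "\<forall>y\<in>sphere a r. y \<noteq> P \<longrightarrow> dist y P < \<rho> \<longrightarrow>
      (Im ((y - P) / (a - P)) * Im ((b - P) / (a - P)) > 0 \<and> y \<in> ball b s) \<or>
      (Im ((y - P) / (a - P)) * Im ((b - P) / (a - P)) < 0 \<and> y \<notin> cball b s)"
      by (elim exE conjE)
    show ?thesis
    proof
      assume "P islimpt ?S"
      then obtain y where y: "y \<in> ?S" "y \<noteq> P" "dist y P < \<rho>"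
        using \<rho> unfolding islimpt_approachable by meson
      then show False using cr[rule_format, of y] by simp
    qed
  qed
  moreover have "compact ?S" by (intro compact_Int compact_sphere)
  ultimately show ?thesis using finite_not_islimpt_in_compact[of ?S ?S] by simp
qed

section \<open>Geometry of the overlapping disks\<close>

locale overlapping_disks =
  fixes N :: nat and c :: "nat \<Rightarrow> complex" and r :: "nat \<Rightarrow> real"
  assumes config: "disk_configuration N c r" and A1: "assumption_A1 N c r"
begin

abbreviation \<Omega> :: "nat \<Rightarrow> complex set" where "\<Omega> j \<equiv> disk c r j"
abbreviation Nb :: "nat \<Rightarrow> nat set" where "Nb j \<equiv> nbrs N c r j"
abbreviation Ext :: "nat \<Rightarrow> complex set" where "Ext j \<equiv> ext_bd N c r j"
abbreviation Dom :: "complex set" where "Dom \<equiv> domain N c r"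

lemma radius_pos: "j \<in> {1..N} \<Longrightarrow> r j > 0"
  using config by (auto simp: disk_configuration_def)

lemma frontier_disk: "j \<in> {1..N} \<Longrightarrow> frontier (\<Omega> j) = sphere (c j) (r j)"
  using radius_pos by (simp add: disk_def)

lemma closure_disk: "j \<in> {1..N} \<Longrightarrow> closure (\<Omega> j) = cball (c j) (r j)"
  using radius_pos by (simp add: disk_def)

lemma open_disk [simp]: "open (\<Omega> j)"
  by (simp add: disk_def)

lemma open_domain: "open Dom"
  by (auto simp: domain_def)

lemma bounded_domain: "bounded Dom"
  by (auto simp: domain_def disk_def)

lemma disk_subset_domain: "j \<in> {1..N} \<Longrightarrow> \<Omega> j \<subseteq> Dom"
  by (auto simp: domain_def)

lemma nbrsD: "i \<in> Nb j \<Longrightarrow> i \<in> {1..N} \<and> i \<noteq> j \<and> \<Omega> i \<inter> \<Omega> j \<noteq> {}"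
  by (simp add: nbrs_def)

lemma nbrs_sym: "j \<in> {1..N} \<Longrightarrow> i \<in> Nb j \<Longrightarrow> j \<in> Nb i"
  by (auto simp: nbrs_def)

lemma finite_nbrs [simp]: "finite (Nb j)"
  by (simp add: nbrs_def)

text \<open>By (A1) each of the two circles has points inside the other disk, so the disks are not nested.\<close>

lemma nbr_circles_transversal:
  assumes "j \<in> {1..N}" "i \<in> Nb j" "P \<in> frontier (\<Omega> j)" "P \<in> frontier (\<Omega> i)"
  shows "Im ((c i - P) / (c j - P)) \<noteq> 0"
proof (rule circles_transversal)
  have i: "i \<in> {1..N}" "i \<noteq> j" "\<Omega> i \<inter> \<Omega> j \<noteq> {}" using nbrsD[OF assms(2)] by auto
  show "P \<in> sphere (c j) (r j)" "P \<in> sphere (c i) (r i)"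
    using assms i frontier_disk by auto
  show "r j > 0" using assms(1) by (rule radius_pos)
  obtain \<Gamma>i \<Gamma>j where \<Gamma>: "\<Gamma>i \<subseteq> frontier (\<Omega> i) \<inter> \<Omega> j" "emeasure (circle_measure (c i) (r i)) \<Gamma>i > 0"
      "\<Gamma>j \<subseteq> frontier (\<Omega> j) \<inter> \<Omega> i" "emeasure (circle_measure (c j) (r j)) \<Gamma>j > 0"
    using A1 i assms(1) unfolding assumption_A1_def by metis
  then have "\<Gamma>i \<noteq> {}" "\<Gamma>j \<noteq> {}" by auto
  then show "sphere (c j) (r j) \<inter> ball (c i) (r i) \<noteq> {}" "sphere (c i) (r i) \<inter> ball (c j) (r j) \<noteq> {}"
    using \<Gamma>(1,3) frontier_disk assms(1) i(1) by (auto simp: disk_def)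
qed

lemma nbr_circles_cross_locally:
  assumes "j \<in> {1..N}" "i \<in> Nb j" "P \<in> frontier (\<Omega> j)" "P \<in> frontier (\<Omega> i)"
  obtains \<rho> where "\<rho> > 0"
    "\<And>y. y \<in> frontier (\<Omega> j) \<Longrightarrow> y \<noteq> P \<Longrightarrow> dist y P < \<rho> \<Longrightarrow>
      (Im ((y - P) / (c j - P)) * Im ((c i - P) / (c j - P)) > 0 \<and> y \<in> \<Omega> i) \<or>
      (Im ((y - P) / (c j - P)) * Im ((c i - P) / (c j - P)) < 0 \<and> y \<notin> closure (\<Omega> i))"
proof -
  have i: "i \<in> {1..N}" using nbrsD[OF assms(2)] by auto
  have P: "P \<in> sphere (c j) (r j)" "P \<in> sphere (c i) (r i)"
    using assms i frontier_disk by auto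
  from circles_cross_locally[OF P radius_pos[OF assms(1)] nbr_circles_transversal[OF assms]]
  obtain \<rho> where "\<rho> > 0" and cr: "\<forall>y\<in>sphere (c j) (r j). y \<noteq> P \<longrightarrow> dist y P < \<rho> \<longrightarrow>
      (Im ((y - P) / (c j - P)) * Im ((c i - P) / (c j - P)) > 0 \<and> y \<in> ball (c i) (r i)) \<or>
      (Im ((y - P) / (c j - P)) * Im ((c i - P) / (c j - P)) < 0 \<and> y \<notin> cball (c i) (r i))"
    by (elim exE conjE)
  show thesis
  proof (rule that[OF \<open>\<rho> > 0\<close>])
    fix y assume y: "y \<in> frontier (\<Omega> j)" "y \<noteq> P" "dist y P < \<rho>"
    from cr[rule_format, OF y(1)[unfolded frontier_disk[OF assms(1)]] y(2,3)]
    show "(Im ((y - P) / (c j - P)) * Im ((c i - P) / (c j - P)) > 0 \<and> y \<in> \<Omega> i) \<or>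
      (Im ((y - P) / (c j - P)) * Im ((c i - P) / (c j - P)) < 0 \<and> y \<notin> closure (\<Omega> i))"
      unfolding closure_disk[OF i] unfolding disk_def .
  qed
qed

lemma frontier_leaves_nbr_nearby:
  assumes "j \<in> {1..N}" "i \<in> Nb j" "P \<in> frontier (\<Omega> j)" "P \<in> frontier (\<Omega> i)" "\<epsilon> > 0"
  obtains y where "y \<in> frontier (\<Omega> j)" "y \<notin> closure (\<Omega> i)" "dist y P < \<epsilon>"
proof -
  have i: "i \<in> {1..N}" using nbrsD[OF assms(2)] by auto
  have P: "P \<in> sphere (c j) (r j)" "P \<in> sphere (c i) (r i)"
    using assms i frontier_disk by auto
  from sphere_leaves_ball_nearby[OF P radius_pos[OF assms(1)] nbr_circles_transversal[OF assms(1-4)] assms(5)]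
  show thesis using that frontier_disk[OF assms(1)] closure_disk[OF i] by blast
qed

lemma finite_nbr_circles:
  assumes "j \<in> {1..N}" "i \<in> Nb j"
  shows "finite (frontier (\<Omega> j) \<inter> frontier (\<Omega> i))"
proof -
  have i: "i \<in> {1..N}" using nbrsD[OF assms(2)] by auto
  show ?thesis
    unfolding frontier_disk[OF assms(1)] frontier_disk[OF i]
    using finite_crossing_circles[OF radius_pos[OF assms(1)], of "c j" "c i" "r i"]
      nbr_circles_transversal[OF assms] frontier_disk[OF assms(1)] frontier_disk[OF i] by blast
qed

lemma frontier_minus_ext: "j \<in> {1..N} \<Longrightarrow> frontier (\<Omega> j) - Ext j = frontier (\<Omega> j) \<inter> Dom"
proof -
  assume j: "j \<in> {1..N}"
  have "frontier (\<Omega> j) \<subseteq> closure Dom"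
    using closure_mono[OF disk_subset_domain[OF j]] by (auto simp: frontier_def)
  moreover have "frontier Dom = closure Dom - Dom" using open_domain by (simp add: frontier_def interior_open)
  ultimately show ?thesis by (auto simp: ext_bd_def)
qed

lemma ext_not_in_disk: "P \<in> Ext j \<Longrightarrow> k \<in> {1..N} \<Longrightarrow> P \<notin> \<Omega> k"
  using open_domain disk_subset_domain[of k] by (auto simp: ext_bd_def frontier_def interior_open)

lemma frontier_point_in_nbr:
  assumes "j \<in> {1..N}" "y \<in> frontier (\<Omega> j)" "y \<in> Dom"
  obtains k where "k \<in> Nb j" "y \<in> \<Omega> k"
proof -
  obtain k where k: "k \<in> {1..N}" "y \<in> \<Omega> k" using assms(3) by (auto simp: domain_def)
  have "y \<notin> \<Omega> j" using assms(2) by (simp add: frontier_def interior_open)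
  then have "k \<noteq> j" using k by auto
  moreover have "y \<in> closure (\<Omega> j)" using assms(2) by (simp add: frontier_def)
  then have "\<Omega> k \<inter> \<Omega> j \<noteq> {}" using k(2) open_Int_closure_eq_empty[OF open_disk, of k "\<Omega> j"] by blast
  ultimately have "k \<in> Nb j" using k(1) by (simp add: nbrs_def)
  then show thesis using that k(2) by blast
qed

lemma bd_interior_subset: "bd_interior c r j A \<subseteq> A"
  unfolding bd_interior_def by (rule interior_of_subset)

lemma arc_subset: "arc N c r j k i \<subseteq> frontier (\<Omega> j) \<inter> \<Omega> k"
  unfolding arc_def by (rule order_trans[OF bd_interior_subset]) auto

lemma nbr_disk_in_domain:
  "i \<in> Nb j \<Longrightarrow> y \<in> \<Omega> i \<Longrightarrow> y \<in> Dom"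
  using nbrsD disk_subset_domain by blast

end

section \<open>The partition of unity at the ends of the interfaces\<close>

locale disk_partition = overlapping_disks +
  fixes chi :: "nat \<Rightarrow> nat \<Rightarrow> complex \<Rightarrow> real"
  assumes pou: "partition_of_unity N c r chi"
begin

abbreviation Int_bd :: "nat \<Rightarrow> complex set" where
  "Int_bd j \<equiv> bd_interior c r j (int_bd N c r j)"

lemmas pou_unfolded = pou[unfolded partition_of_unity_def, THEN bspec]
lemmas pou_nbr = pou_unfolded[THEN conjunct1, THEN bspec]

lemma chi_continuous: "j \<in> {1..N} \<Longrightarrow> k \<in> Nb j \<Longrightarrow> continuous_on (Int_bd j) (chi j k)"
  by (drule (1) pou_nbr) (elim conjE)

lemma chi_sum: "j \<in> {1..N} \<Longrightarrow> x \<in> Int_bd j \<Longrightarrow> (\<Sum>k\<in>Nb j. chi j k x) = 1"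
  by (drule pou_unfolded, elim conjE, drule (1) bspec)

lemma chi_zero_otherwise:
  assumes "j \<in> {1..N}" "k \<in> Nb j" "x \<in> frontier (\<Omega> j)" "\<not> x isolated_in Ext j"
    "x \<notin> (\<Union>i \<in> common_nbrs0 N c r j k. closure (arc N c r j k i) - Ext j)"
  shows "chi j k x = 0"
  using pou_nbr[OF assms(1,2), THEN conjunct2, THEN conjunct2, THEN conjunct2, THEN bspec, OF assms(3)]
    assms(4,5) by (rule_tac mp) (assumption, rule conjI)

lemma chi_eq_0_outside_closure:
  assumes "j \<in> {1..N}" "k \<in> Nb j" "x \<in> frontier (\<Omega> j) - Ext j" "x \<notin> closure (\<Omega> k)"
  shows "chi j k x = 0"
proof (rule chi_zero_otherwise[OF assms(1,2)])
  have "x \<notin> closure (arc N c r j k i)" for i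
    using closure_mono[of "arc N c r j k i" "\<Omega> k"] arc_subset[of j k i] assms(4) by blast
  then show "x \<notin> (\<Union>i \<in> common_nbrs0 N c r j k. closure (arc N c r j k i) - Ext j)" by blast
  show "\<not> x isolated_in Ext j" using assms(3) by (auto simp: isolated_in_def)
  show "x \<in> frontier (\<Omega> j)" using assms(3) by blast
qed

lemma chi_nonneg:
  assumes "j \<in> {1..N}" "k \<in> Nb j" "x \<in> frontier (\<Omega> j) - Ext j"
  shows "chi j k x \<ge> 0"
proof (cases "x \<in> (\<Union>i \<in> common_nbrs0 N c r j k. closure (arc N c r j k i) - Ext j)")
  case True
  then obtain i where i: "i \<in> common_nbrs0 N c r j k" "x \<in> closure (arc N c r j k i) - Ext j" by blast
  have "chi j k x = 1 \<or> chi j k x \<in> {0..1}"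
  proof (cases "i = 0")
    case True
    show ?thesis
      using pou_nbr[OF assms(1,2), THEN conjunct2, THEN conjunct1, THEN bspec] i(2) True by simp
  next
    case False
    show ?thesis
      using pou_nbr[OF assms(1,2), THEN conjunct2, THEN conjunct2, THEN conjunct1, THEN bspec, THEN bspec] i False
      by blast
  qed
  then show ?thesis by auto
next
  case False
  then show ?thesis
    using chi_zero_otherwise[OF assms(1,2)] assms(3) by (auto simp: isolated_in_def)
qed

lemma Int_bd_openin: "openin (top_of_set (frontier (\<Omega> j))) (Int_bd j)"
  unfolding bd_interior_def by (rule openin_interior_of)

lemma Int_bd_subset: "Int_bd j \<subseteq> int_bd N c r j" "Int_bd j \<subseteq> frontier (\<Omega> j)"
  using bd_interior_subset interior_of_subset_topspace[of "top_of_set (frontier (\<Omega> j))"]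
  unfolding bd_interior_def by auto

lemma Int_bd_ball:
  assumes "P \<in> Int_bd j"
  obtains e where "e > 0" "\<And>y. y \<in> frontier (\<Omega> j) \<Longrightarrow> dist y P < e \<Longrightarrow> y \<in> Int_bd j"
  using Int_bd_openin[of j] assms unfolding openin_euclidean_subtopology_iff by metis

lemma ball_imp_Int_bd:
  assumes "P \<in> frontier (\<Omega> j)" "e > 0"
    and "\<And>y. y \<in> frontier (\<Omega> j) \<Longrightarrow> dist y P < e \<Longrightarrow> y \<in> int_bd N c r j"
  shows "P \<in> Int_bd j"
proof -
  let ?T = "frontier (\<Omega> j) \<inter> ball P e"
  have "openin (top_of_set (frontier (\<Omega> j))) ?T" by (simp add: openin_open_Int)
  moreover have "?T \<subseteq> int_bd N c r j" using assms(3) by (auto simp: dist_commute)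
  ultimately have "?T \<subseteq> Int_bd j" unfolding bd_interior_def by (rule interior_of_maximal[rotated])
  then show ?thesis using assms(1,2) by auto
qed

lemma nonext_subset_Int_bd:
  assumes j: "j \<in> {1..N}"
  shows "frontier (\<Omega> j) - Ext j \<subseteq> Int_bd j"
proof -
  have "openin (top_of_set (frontier (\<Omega> j))) (frontier (\<Omega> j) - Ext j)"
    unfolding frontier_minus_ext[OF j] using open_domain by (rule openin_open_Int)
  moreover have "frontier (\<Omega> j) - Ext j \<subseteq> int_bd N c r j"
    unfolding int_bd_def by (rule closure_subset)
  ultimately show ?thesis unfolding bd_interior_def by (rule interior_of_maximal[rotated])
qed

text \<open>For \<open>P\<close> on the circle \<open>\<partial>\<Omega>\<^sub>k\<close> the side of \<open>P\<close> away from \<open>\<Omega>\<^sub>k\<close> consists of points where \<open>\<chi>\<^sub>j\<^sup>k = 0\<close>, and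
continuity carries this to \<open>P\<close>. The points of that side that are used must be in the interface itself,
since at isolated points of \<open>\<Gamma>\<^sub>j\<^sup>e\<^sup>x\<^sup>t\<close> the values of \<open>\<chi>\<^sub>j\<^sup>k\<close> are not prescribed; they are found because \<open>\<Gamma>\<^sub>j\<^sup>i\<^sup>n\<^sup>t\<close>
is the closure of the interface.\<close>

lemma chi_eq_0_outside:
  assumes j: "j \<in> {1..N}" and k: "k \<in> Nb j" and P: "P \<in> Int_bd j" "P \<notin> \<Omega> k"
  shows "chi j k P = 0"
proof (rule ccontr)
  assume ne: "chi j k P \<noteq> 0"
  have Pf: "P \<in> frontier (\<Omega> j)" using P(1) Int_bd_subset by blast
  obtain e1 where e1: "e1 > 0" "\<And>y. y \<in> Int_bd j \<Longrightarrow> dist y P < e1 \<Longrightarrow> chi j k y \<noteq> 0"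
  proof -
    obtain d where "d > 0" "\<And>y. y \<in> Int_bd j \<Longrightarrow> dist y P < d \<Longrightarrow> dist (chi j k y) (chi j k P) < \<bar>chi j k P\<bar>"
      using chi_continuous[OF j k] P(1) ne unfolding continuous_on_iff by (metis zero_less_abs_iff)
    then show thesis using that[of d] by (force simp: dist_real_def)
  qed
  obtain e2 where e2: "e2 > 0" "\<And>y. y \<in> frontier (\<Omega> j) \<Longrightarrow> dist y P < e2 \<Longrightarrow> y \<in> Int_bd j"
    using Int_bd_ball[OF P(1)] by blast
  define e where "e = min e1 e2"
  have e: "e > 0" using e1 e2 by (simp add: e_def)
  obtain y0 where y0: "y0 \<in> frontier (\<Omega> j)" "y0 \<notin> closure (\<Omega> k)" "dist y0 P < e"
  proof (cases "P \<in> closure (\<Omega> k)")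
    case True
    then have "P \<in> frontier (\<Omega> k)" using P(2) by (simp add: frontier_def interior_open)
    then show thesis using frontier_leaves_nbr_nearby[OF j k Pf _ e] that by blast
  next
    case False
    then show thesis using that[of P] Pf e by simp
  qed
  have "y0 \<in> int_bd N c r j" using e2(2)[OF y0(1)] y0(3) Int_bd_subset by (auto simp: e_def)
  then have "y0 \<in> closure (frontier (\<Omega> j) - Ext j)" by (simp add: int_bd_def)
  moreover have "open (ball P e - closure (\<Omega> k))" by (intro open_Diff) auto
  moreover have "y0 \<in> ball P e - closure (\<Omega> k)" using y0 by (simp add: dist_commute)
  ultimately obtain y where y: "y \<in> ball P e - closure (\<Omega> k)" "y \<in> frontier (\<Omega> j) - Ext j"
    using open_Int_closure_eq_empty by blast
  then have "chi j k y = 0" using chi_eq_0_outside_closure[OF j k] by blast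
  moreover have "chi j k y \<noteq> 0"
    using y nonext_subset_Int_bd[OF j] e1(2)[of y] by (auto simp: e_def dist_commute)
  ultimately show False by simp
qed

text \<open>A point of \<open>\<partial>\<Omega>\<close> lies in no disk, so all \<open>\<chi>\<^sub>j\<^sup>k\<close> would vanish there, contradicting the sum
condition. In particular \<open>\<Gamma>\<^sub>j\<^sup>e\<^sup>x\<^sup>t\<close> has no isolated points once a partition of unity exists.\<close>

lemma Int_bd_eq:
  assumes j: "j \<in> {1..N}"
  shows "Int_bd j = frontier (\<Omega> j) - Ext j"
proof
  show "Int_bd j \<subseteq> frontier (\<Omega> j) - Ext j"
  proof
    fix P assume P: "P \<in> Int_bd j"
    have "\<exists>k\<in>Nb j. chi j k P \<noteq> 0"
      using chi_sum[OF j P] sum.neutral[of "Nb j" "\<lambda>k. chi j k P"] by fastforce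
    then obtain k where k: "k \<in> Nb j" "P \<in> \<Omega> k" using chi_eq_0_outside[OF j _ P] by blast
    then have "P \<notin> Ext j" using ext_not_in_disk nbrsD by blast
    then show "P \<in> frontier (\<Omega> j) - Ext j" using P Int_bd_subset by blast
  qed
qed (rule nonext_subset_Int_bd[OF j])

text \<open>At a point \<open>P \<in> \<partial>\<Omega>\<close> where \<open>\<partial>\<Omega>\<^sub>i\<close> and \<open>\<partial>\<Omega>\<^sub>j\<close> cross, one side of \<open>P\<close> on \<open>\<partial>\<Omega>\<^sub>i\<close> is covered by \<open>\<Omega>\<^sub>j\<close>. If a point
of the other side close to \<open>P\<close> were covered by some \<open>\<Omega>\<^sub>k\<close>, then all of that side near \<open>P\<close> would be, since
\<open>\<partial>\<Omega>\<^sub>k\<close> also passes through \<open>P\<close>. Both sides would be in the interface, and \<open>P\<close> in the relative interior of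
\<open>\<Gamma>\<^sub>i\<^sup>i\<^sup>n\<^sup>t\<close>, which has been excluded.\<close>

lemma corner_side_exterior:
  assumes i: "i \<in> {1..N}" and j: "j \<in> Nb i"
    and P: "P \<in> frontier (\<Omega> i)" "P \<in> frontier (\<Omega> j)" "P \<notin> Dom"
  obtains \<rho> where "\<rho> > 0"
    "\<And>y. y \<in> frontier (\<Omega> i) - Ext i \<Longrightarrow> dist y P < \<rho> \<Longrightarrow>
       Im ((y - P) / (c i - P)) * Im ((c j - P) / (c i - P)) > 0"
proof -
  let ?t = "\<lambda>y. Im ((y - P) / (c i - P))" and ?q = "\<lambda>k. Im ((c k - P) / (c i - P))"
  have Pext: "P \<in> Ext i" using P(1,3) frontier_minus_ext[OF i] by blast
  have "\<exists>\<rho>>0. \<forall>y\<in>frontier (\<Omega> i). y \<noteq> P \<longrightarrow> dist y P < \<rho> \<longrightarrow>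
      (if P \<in> frontier (\<Omega> k) then (?t y * ?q k > 0 \<and> y \<in> \<Omega> k) \<or> (?t y * ?q k < 0 \<and> y \<notin> \<Omega> k)
       else y \<notin> \<Omega> k)" if k: "k \<in> Nb i" for k
  proof (cases "P \<in> frontier (\<Omega> k)")
    case True
    obtain \<rho> where \<rho>: "\<rho> > 0"
      "\<And>y. y \<in> frontier (\<Omega> i) \<Longrightarrow> y \<noteq> P \<Longrightarrow> dist y P < \<rho> \<Longrightarrow>
        (?t y * ?q k > 0 \<and> y \<in> \<Omega> k) \<or> (?t y * ?q k < 0 \<and> y \<notin> closure (\<Omega> k))"
      using nbr_circles_cross_locally[OF i k P(1) True] by metis
    have "(?t y * ?q k > 0 \<and> y \<in> \<Omega> k) \<or> (?t y * ?q k < 0 \<and> y \<notin> \<Omega> k)"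
      if "y \<in> frontier (\<Omega> i)" "y \<noteq> P" "dist y P < \<rho>" for y
      using \<rho>(2)[OF that] closure_subset[of "\<Omega> k"] by blast
    then show ?thesis using \<rho>(1) True by (intro exI[of _ \<rho>]) simp
  next
    case False
    have "P \<notin> \<Omega> k" using ext_not_in_disk[OF Pext] nbrsD[OF k] by blast
    then have "P \<notin> closure (\<Omega> k)" using False by (simp add: frontier_def interior_open)
    then obtain \<rho> where \<rho>: "\<rho> > 0" "ball P \<rho> \<subseteq> - closure (\<Omega> k)"
      by (metis ComplI closed_closure open_Compl openE)
    have "y \<notin> \<Omega> k" if "dist y P < \<rho>" for y
      using \<rho>(2) that closure_subset[of "\<Omega> k"] by (force simp: dist_commute)
    then show ?thesis using \<rho>(1) False by (intro exI[of _ \<rho>]) simp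
  qed
  then obtain R where R: "\<And>k. k \<in> Nb i \<Longrightarrow> R k > 0"
    "\<And>k y. k \<in> Nb i \<Longrightarrow> y \<in> frontier (\<Omega> i) \<Longrightarrow> y \<noteq> P \<Longrightarrow> dist y P < R k \<Longrightarrow>
      (if P \<in> frontier (\<Omega> k) then (?t y * ?q k > 0 \<and> y \<in> \<Omega> k) \<or> (?t y * ?q k < 0 \<and> y \<notin> \<Omega> k)
       else y \<notin> \<Omega> k)"
    by metis
  define \<rho> where "\<rho> = Min (R ` Nb i)"
  have ne: "Nb i \<noteq> {}" using j by auto
  have \<rho>: "\<rho> > 0" "\<And>k. k \<in> Nb i \<Longrightarrow> \<rho> \<le> R k"
    using R(1) ne by (auto simp: \<rho>_def)
  have j': "?t y * ?q j > 0 \<and> y \<in> \<Omega> j \<or> ?t y * ?q j < 0 \<and> y \<notin> \<Omega> j"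
    if "y \<in> frontier (\<Omega> i)" "y \<noteq> P" "dist y P < \<rho>" for y
    using R(2)[OF j that(1,2)] \<rho>(2)[OF j] that(3) P(2) by simp
  show thesis
  proof (rule that[OF \<rho>(1)], rule ccontr)
    fix y assume y: "y \<in> frontier (\<Omega> i) - Ext i" "dist y P < \<rho>" and neg: "\<not> ?t y * ?q j > 0"
    have yP: "y \<noteq> P" using y(1) Pext by blast
    have tj: "?t y * ?q j < 0" using j'[of y] y yP neg by blast
    obtain k where k: "k \<in> Nb i" "y \<in> \<Omega> k"
      using frontier_point_in_nbr[OF i, of y] y(1) frontier_minus_ext[OF i] by blast
    have ky: "(if P \<in> frontier (\<Omega> k) then (?t y * ?q k > 0 \<and> y \<in> \<Omega> k) \<or> (?t y * ?q k < 0 \<and> y \<notin> \<Omega> k)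
       else y \<notin> \<Omega> k)"
      using R(2)[OF k(1), of y] \<rho>(2)[OF k(1)] y yP by simp
    then have Pk: "P \<in> frontier (\<Omega> k)" and tk: "?t y * ?q k > 0" using k(2) by (auto split: if_splits)
    \<comment> \<open>The disks \<open>\<Omega>\<^sub>j\<close> and \<open>\<Omega>\<^sub>k\<close> cover opposite sides of \<open>P\<close>.\<close>
    have opp: "?q j * ?q k < 0"
    proof -
      have "(?t y * ?q j) * (?t y * ?q k) < 0" using tj tk by (rule mult_neg_pos)
      then have "(?t y)\<^sup>2 * (?q j * ?q k) < 0" by (simp only: power2_eq_square mult_ac)
      then show ?thesis by (meson zero_le_power2 mult_less_0_iff not_less)
    qed
    have near: "z \<in> frontier (\<Omega> i) - Ext i" if z: "z \<in> frontier (\<Omega> i)" "z \<noteq> P" "dist z P < \<rho>" for z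
    proof -
      have "z \<in> \<Omega> j \<or> z \<in> \<Omega> k"
      proof (rule ccontr)
        assume no: "\<not> (z \<in> \<Omega> j \<or> z \<in> \<Omega> k)"
        then have "?t z * ?q j < 0" "?t z * ?q k < 0"
          using j'[OF z] R(2)[OF k(1) z(1,2)] \<rho>(2)[OF k(1)] z(3) Pk by auto
        then have "0 < (?t z * ?q j) * (?t z * ?q k)" by (rule mult_neg_neg)
        then have "0 < (?t z)\<^sup>2 * (?q j * ?q k)" by (simp only: power2_eq_square mult_ac)
        then show False using opp by (meson zero_le_power2 mult_nonneg_nonpos less_imp_le not_less)
      qed
      then have "z \<in> Dom" using j k(1) nbr_disk_in_domain by blast
      then show ?thesis using z(1) frontier_minus_ext[OF i] by blast
    qed
    have "P \<in> int_bd N c r i"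
      unfolding int_bd_def closure_approachable
    proof (intro allI impI)
      fix e :: real assume "e > 0"
      then obtain z where z: "z \<in> frontier (\<Omega> i)" "z \<notin> closure (\<Omega> j)" "dist z P < min e \<rho>"
        using frontier_leaves_nbr_nearby[OF i j P(1,2), of "min e \<rho>"] \<rho>(1) by auto
      then have "z \<noteq> P" using P(2) by (auto simp: frontier_def)
      then show "\<exists>z\<in>frontier (\<Omega> i) - Ext i. dist z P < e" using near[of z] z by auto
    qed
    then have "z \<in> int_bd N c r i" if "z \<in> frontier (\<Omega> i)" "dist z P < \<rho>" for z
    proof (cases "z = P")
      case False
      then have "z \<in> frontier (\<Omega> i) - Ext i" using near that by blast
      then show ?thesis unfolding int_bd_def by (rule subsetD[OF closure_subset])
    qed (use \<open>P \<in> int_bd N c r i\<close> in simp)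
    then have "P \<in> Int_bd i" using ball_imp_Int_bd[OF P(1) \<rho>(1)] by blast
    then show False using Int_bd_eq[OF i] Pext by blast
  qed
qed

end

section \<open>A superharmonic weight\<close>

context overlapping_disks
begin

definition rad :: real where
  "rad = (SOME B. \<forall>z\<in>closure Dom. norm z \<le> B)"

definition \<phi> :: "complex \<Rightarrow> real" where
  "\<phi> z = 1 + rad\<^sup>2 - (norm z)\<^sup>2"

text \<open>The affine function that agrees with \<open>\<phi>\<close> on the circle \<open>\<partial>\<Omega>\<^sub>j\<close>: subtracting the power of \<open>z\<close> with
respect to the circle removes the quadratic term.\<close>

definition \<alpha> :: "nat \<Rightarrow> complex \<Rightarrow> real" where
  "\<alpha> j z = \<phi> z - ((r j)\<^sup>2 - (dist (c j) z)\<^sup>2)"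

lemma norm_le_rad: "z \<in> closure Dom \<Longrightarrow> norm z \<le> rad"
proof -
  have "bounded (closure Dom)" using bounded_domain by (rule bounded_closure)
  then have "\<exists>B. \<forall>z\<in>closure Dom. norm z \<le> B" by (simp only: bounded_iff)
  then have "\<forall>z\<in>closure Dom. norm z \<le> rad" unfolding rad_def by (rule someI_ex)
  then show "z \<in> closure Dom \<Longrightarrow> norm z \<le> rad" by blast
qed

lemma \<phi>_bounds: "z \<in> closure Dom \<Longrightarrow> 1 \<le> \<phi> z" "\<phi> z \<le> 1 + rad\<^sup>2"
  using norm_le_rad[of z] by (auto simp: \<phi>_def power_mono)

lemma closure_disk_subset: "j \<in> {1..N} \<Longrightarrow> closure (\<Omega> j) \<subseteq> closure Dom"
  by (intro closure_mono disk_subset_domain)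

lemma \<alpha>_eq_frontier: "j \<in> {1..N} \<Longrightarrow> z \<in> frontier (\<Omega> j) \<Longrightarrow> \<alpha> j z = \<phi> z"
  by (simp add: frontier_disk \<alpha>_def)

lemma \<alpha>_less_inside: "z \<in> \<Omega> j \<Longrightarrow> \<alpha> j z < \<phi> z"
  by (simp add: \<alpha>_def disk_def power_strict_mono)

lemma \<alpha>_affine: "\<alpha> j z = Re (1 + (rad\<^sup>2 + (norm (c j))\<^sup>2 - (r j)\<^sup>2) - 2 * cnj (c j) * z)"
  unfolding \<alpha>_def \<phi>_def dist_norm cmod_power2 by (simp add: power2_eq_square algebra_simps)

lemma \<alpha>_harmonic: "harmonic_on (\<alpha> j) (\<Omega> j)"
proof -
  have "harmonic_on (\<lambda>z. Re (1 + (rad\<^sup>2 + (norm (c j))\<^sup>2 - (r j)\<^sup>2) - 2 * cnj (c j) * z)) (\<Omega> j)"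
    by (intro harmonic_on_Re_holomorphic holomorphic_intros) auto
  then show ?thesis unfolding \<alpha>_affine[symmetric] .
qed

lemma \<alpha>_continuous [continuous_intros]: "continuous_on S (\<alpha> j)"
  unfolding \<alpha>_def \<phi>_def by (intro continuous_intros)

lemma \<alpha>_bounded: "bounded (\<alpha> j ` \<Omega> j)"
proof -
  have "compact (\<alpha> j ` closure (\<Omega> j))"
    by (intro compact_continuous_image \<alpha>_continuous) (simp add: disk_def)
  then show ?thesis
    using bounded_subset[OF compact_imp_bounded] closure_subset by (meson image_mono)
qed

text \<open>The class of errors after one step whose interface data are bounded by \<open>K \<phi>\<close>. Finitely many
boundary points are left free, as in the Dirichlet conditions.\<close>

definition dominated :: "real \<Rightarrow> (nat \<Rightarrow> complex \<Rightarrow> real) \<Rightarrow> bool" where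
  "dominated K w \<longleftrightarrow> (\<forall>i\<in>{1..N}. bounded_harmonic_on (w i) (\<Omega> i) \<and>
     (\<exists>F. finite F \<and> (\<forall>y\<in>frontier (\<Omega> i) - F. \<exists>l. (w i \<longlongrightarrow> l) (at y within \<Omega> i) \<and>
        \<bar>l\<bar> \<le> (if y \<in> Ext i then 0 else K * \<phi> y))))"

lemma dominated_comparison:
  assumes "dominated K w" and i: "i \<in> {1..N}"
    and h: "harmonic_on h (\<Omega> i)" "bounded (h ` \<Omega> i)" and "finite F"
    and lim: "\<And>y. y \<in> frontier (\<Omega> i) - F \<Longrightarrow> \<exists>l. (h \<longlongrightarrow> l) (at y within \<Omega> i) \<and>
       (if y \<in> Ext i then 0 else K * \<phi> y) \<le> l"
    and x: "x \<in> \<Omega> i"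
  shows "\<bar>w i x\<bar> \<le> h x"
proof -
  have w: "bounded_harmonic_on (w i) (\<Omega> i)" 
    and "\<exists>F. finite F \<and> (\<forall>y\<in>frontier (\<Omega> i) - F. \<exists>l. (w i \<longlongrightarrow> l) (at y within \<Omega> i) \<and>
        \<bar>l\<bar> \<le> (if y \<in> Ext i then 0 else K * \<phi> y))"
    using assms(1) i unfolding dominated_def by blast+
  then obtain F' where F': "finite F'" "\<And>y. y \<in> frontier (\<Omega> i) - F' \<Longrightarrow>
      \<exists>l. (w i \<longlongrightarrow> l) (at y within \<Omega> i) \<and> \<bar>l\<bar> \<le> (if y \<in> Ext i then 0 else K * \<phi> y)"
    by blast
  have wh: "harmonic_on (w i) (\<Omega> i)" "bounded (w i ` \<Omega> i)"
    using w by (auto simp: bounded_harmonic_on_def)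
  have "a * w i x + (- 1) * h x \<le> 0" if a: "\<bar>a\<bar> = 1" for a :: real
  proof (rule bounded_harmonic_max_principle_ball[where F = "F \<union> F'" and c = "c i" and r = "r i",
      folded disk_def])
    show "harmonic_on (\<lambda>x. a * w i x + (- 1) * h x) (\<Omega> i)"
      by (intro harmonic_on_add harmonic_on_cmult wh h)
    obtain A1 A2 where A: "\<And>z. z \<in> \<Omega> i \<Longrightarrow> \<bar>w i z\<bar> \<le> A1" "\<And>z. z \<in> \<Omega> i \<Longrightarrow> \<bar>h z\<bar> \<le> A2"
      using wh(2) h(2) unfolding bounded_iff by (auto simp: ball_simps)
    have "\<bar>a * w i z + (- 1) * h z\<bar> \<le> A1 + A2" if "z \<in> \<Omega> i" for z
      using abs_triangle_ineq4[of "a * w i z" "h z"] A[OF that] a by (simp add: abs_mult)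
    then show "bounded ((\<lambda>x. a * w i x + (- 1) * h x) ` \<Omega> i)"
      unfolding bounded_iff by auto
    fix y assume y: "y \<in> frontier (\<Omega> i) - (F \<union> F')"
    obtain l where l: "(h \<longlongrightarrow> l) (at y within \<Omega> i)" "(if y \<in> Ext i then 0 else K * \<phi> y) \<le> l"
      using lim[of y] y by blast
    obtain l' where l': "(w i \<longlongrightarrow> l') (at y within \<Omega> i)" "\<bar>l'\<bar> \<le> (if y \<in> Ext i then 0 else K * \<phi> y)"
      using F'(2)[of y] y by blast
    have "a * l' \<le> \<bar>l'\<bar>" using a abs_ge_self[of "a * l'"] by (simp add: abs_mult)
    then have "a * l' + (- 1) * l \<le> 0" using l(2) l'(2) by linarith
    moreover have "((\<lambda>x. a * w i x + (- 1) * h x) \<longlongrightarrow> a * l' + (- 1) * l) (at y within \<Omega> i)"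
      by (intro tendsto_intros l l')
    ultimately show "\<exists>l\<le>0. ((\<lambda>x. a * w i x + (- 1) * h x) \<longlongrightarrow> l) (at y within \<Omega> i)" by blast
  qed (use \<open>finite F\<close> F'(1) x in auto)
  from this[of 1] this[of "-1"] show ?thesis by auto
qed

lemma dominated_le_\<alpha>:
  assumes "dominated K w" "K \<ge> 0" and i: "i \<in> {1..N}" and x: "x \<in> \<Omega> i"
  shows "\<bar>w i x\<bar> \<le> K * \<alpha> i x"
proof (rule dominated_comparison[OF assms(1) i _ _ finite.emptyI _ x])
  show "harmonic_on (\<lambda>x. K * \<alpha> i x) (\<Omega> i)" by (intro harmonic_on_cmult \<alpha>_harmonic)
  show "bounded ((\<lambda>x. K * \<alpha> i x) ` \<Omega> i)"
    using bounded_scaleR_comp[OF \<alpha>_bounded, of K] by simp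
  fix y assume y: "y \<in> frontier (\<Omega> i) - {}"
  have "(\<alpha> i \<longlongrightarrow> \<alpha> i y) (at y within \<Omega> i)"
    using \<alpha>_continuous[of UNIV i] unfolding continuous_on_def
    by (blast intro: tendsto_within_subset)
  then have "((\<lambda>x. K * \<alpha> i x) \<longlongrightarrow> K * \<alpha> i y) (at y within \<Omega> i)" by (intro tendsto_intros)
  moreover have "\<alpha> i y = \<phi> y" using \<alpha>_eq_frontier[OF i] y by simp
  moreover have "1 \<le> \<phi> y"
    using y closure_disk_subset[OF i] by (intro \<phi>_bounds) (auto simp: frontier_def)
  ultimately show "\<exists>l. ((\<lambda>x. K * \<alpha> i x) \<longlongrightarrow> l) (at y within \<Omega> i) \<and>
     (if y \<in> Ext i then 0 else K * \<phi> y) \<le> l"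
    using assms(2) by (intro exI[of _ "K * \<phi> y"]) auto
qed

end

section \<open>The barrier at a corner of the domain\<close>

context disk_partition
begin

text \<open>In the coordinate \<open>\<zeta> = (z - P) / (c\<^sub>i - P)\<close> the disk \<open>\<Omega>\<^sub>i\<close> lies in the right half plane, where
\<open>arctan (Im \<zeta> / Re \<zeta>)\<close> is the argument of \<open>\<zeta>\<close>. Along \<open>\<partial>\<Omega>\<^sub>i\<close> it tends to \<open>\<pi>/2\<close> on one side of \<open>P\<close> and to
\<open>-\<pi>/2\<close> on the other; on the circle \<open>\<partial>\<Omega>\<^sub>j\<close> inside \<open>\<Omega>\<^sub>i\<close> it stays within \<open>\<plusminus> arctan C\<close>. With the sign \<open>sgn q\<close> of the
side covered by \<open>\<Omega>\<^sub>j\<close>, the barrier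
\<open>\<beta> = arctan (C + 1) - sgn q arctan (Im \<zeta> / Re \<zeta>) - L Re \<zeta>\<close> is nonpositive on the interface of \<open>\<Omega>\<^sub>i\<close>: close
to \<open>P\<close> because the argument exceeds \<open>arctan (C + 1)\<close>, farther away because \<open>L\<close> is large. It is
at most \<open>4\<close> on the exterior boundary, where the error vanishes and \<open>\<phi> \<ge> 1\<close>, and it is bounded below by a
positive constant on the part of \<open>\<partial>\<Omega>\<^sub>j\<close> in \<open>\<Omega>\<^sub>i\<close> near \<open>P\<close>. Comparison with \<open>\<alpha>\<^sub>i - \<beta> / 4\<close> gives the gain.\<close>

lemma corner_barrier:
  assumes i: "i \<in> {1..N}" and j: "j \<in> Nb i"
    and P: "P \<in> frontier (\<Omega> i)" "P \<in> frontier (\<Omega> j)" "P \<notin> Dom"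
  obtains \<rho> \<eta> where "\<rho> > 0" "\<eta> > 0"
    "\<And>K w x. K \<ge> 0 \<Longrightarrow> dominated K w \<Longrightarrow> x \<in> frontier (\<Omega> j) \<inter> \<Omega> i \<Longrightarrow> dist x P < \<rho> \<Longrightarrow>
       \<bar>w i x\<bar> \<le> K * (\<alpha> i x - \<eta>)"
proof -
  define \<zeta> where "\<zeta> = (\<lambda>z. (z - P) / (c i - P))"
  define p q where "p = Re ((c j - P) / (c i - P))" and "q = Im ((c j - P) / (c i - P))"
  have jN: "j \<in> {1..N}" using nbrsD[OF j] by blast
  have q: "q \<noteq> 0" using nbr_circles_transversal[OF i j P(1,2)] by (simp add: q_def)
  have ri: "r i > 0" using radius_pos[OF i] .
  have Pi: "P \<in> sphere (c i) (r i)" and Pj: "P \<in> sphere (c j) (r j)"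
    using P frontier_disk[OF i] frontier_disk[OF jN] by auto
  have cP: "c i \<noteq> P" "dist (c i) P = r i" using Pi ri by auto
  have n\<zeta>: "norm (\<zeta> z) = dist z P / r i" for z
    using cP by (simp add: \<zeta>_def norm_divide dist_norm norm_minus_commute)
  have self: "z \<in> \<Omega> i \<longleftrightarrow> (norm (\<zeta> z))\<^sup>2 < 2 * Re (\<zeta> z)"
    "z \<in> frontier (\<Omega> i) \<longleftrightarrow> (norm (\<zeta> z))\<^sup>2 = 2 * Re (\<zeta> z)" for z
    unfolding frontier_disk[OF i] unfolding disk_def \<zeta>_def
    using ball_sphere_quotient_self[OF cP] by auto
  have Re_in: "Re (\<zeta> z) > 0" if "z \<in> \<Omega> i" for z
    using self(1)[of z] that zero_le_power2[of "norm (\<zeta> z)"] by linarith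
  have Re_fr: "Re (\<zeta> z) > 0" if "z \<in> frontier (\<Omega> i)" "z \<noteq> P" for z
  proof -
    have "0 < (norm (\<zeta> z))\<^sup>2" using that(2) cP(1) by (simp add: \<zeta>_def)
    then show ?thesis using self(2)[of z] that(1) by linarith
  qed
  define C where "C = (1 + \<bar>p\<bar>) / \<bar>q\<bar>"
  have C: "C > 0" unfolding C_def using q by (intro divide_pos_pos) auto
  obtain \<rho>1 where \<rho>1: "\<rho>1 > 0"
    "\<And>y. y \<in> frontier (\<Omega> i) - Ext i \<Longrightarrow> dist y P < \<rho>1 \<Longrightarrow> Im (\<zeta> y) * q > 0"
    using corner_side_exterior[OF i j P] unfolding \<zeta>_def q_def by blast
  \<comment> \<open>On the circle \<open>|Im \<zeta>| / Re \<zeta>\<close> is at least \<open>C + 1\<close> as soon as \<open>Re \<zeta> \<le> 1 / (1 + (C + 1)\<^sup>2)\<close>.\<close>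
  define \<rho>0 where "\<rho>0 = min (\<rho>1 / r i) (1 / (1 + (C + 1)\<^sup>2))"
  have d: "1 + (C + 1)\<^sup>2 > 0" by (simp add: add_pos_nonneg)
  have \<rho>0: "\<rho>0 > 0" using \<rho>1(1) ri d by (simp add: \<rho>0_def)
  \<comment> \<open>Points of the circle with \<open>|\<zeta>| \<ge> \<rho>0\<close> have \<open>Re \<zeta> \<ge> \<rho>0\<^sup>2 / 2\<close>, so that \<open>L Re \<zeta> \<ge> \<pi>\<close> outweighs the other terms of \<open>\<beta>\<close>.\<close>
  define L where "L = 2 * pi / \<rho>0\<^sup>2"
  have L: "L > 0" using \<rho>0 by (simp add: L_def)
  define \<beta> where "\<beta> = (\<lambda>z. arctan (C + 1) - sgn q * arctan (Im (\<zeta> z) / Re (\<zeta> z)) - L * Re (\<zeta> z))"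
  have sgnq: "sgn q = 1 \<or> sgn q = - 1" using q by (auto simp: sgn_if)
  have arc_le: "sgn q * arctan t \<le> pi / 2" "- (sgn q * arctan t) \<le> pi / 2" for t
    using sgnq arctan_bounded[of t] by auto
  have \<beta>_le: "\<beta> z \<le> 4" if "Re (\<zeta> z) > 0" for z
  proof -
    have "L * Re (\<zeta> z) \<ge> 0" using L that by simp
    then show ?thesis
      using arctan_bounded[of "C + 1"] arc_le[of "Im (\<zeta> z) / Re (\<zeta> z)"] pi_less_4
      unfolding \<beta>_def by linarith
  qed
  have \<beta>_int: "\<beta> y \<le> 0" if y: "y \<in> frontier (\<Omega> i) - Ext i" for y
  proof -
    have "y \<noteq> P" using y P frontier_minus_ext[OF i] by blast
    then have x0: "Re (\<zeta> y) > 0" using Re_fr y by blast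
    have circ: "(norm (\<zeta> y))\<^sup>2 = 2 * Re (\<zeta> y)" using self(2) y by blast
    show ?thesis
    proof (cases "norm (\<zeta> y) < \<rho>0")
      case True
      let ?x = "Re (\<zeta> y)" and ?t = "Im (\<zeta> y)"
      have "dist y P < \<rho>1"
        using True ri unfolding n\<zeta> \<rho>0_def by (simp add: divide_less_cancel)
      then have tq: "?t * q > 0" using \<rho>1(2) y by blast
      have "?x < 1 / (1 + (C + 1)\<^sup>2)"
        using True complex_Re_le_cmod[of "\<zeta> y"] by (simp add: \<rho>0_def)
      then have "(1 + (C + 1)\<^sup>2) * ?x < 1" using d by (simp add: pos_less_divide_eq mult.commute)
      then have "((1 + (C + 1)\<^sup>2) * ?x) * ?x \<le> 1 * ?x" using x0 by (intro mult_right_mono) auto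
      then have "((C + 1) * ?x)\<^sup>2 \<le> 2 * ?x - ?x\<^sup>2"
        using x0 by (simp add: power2_eq_square algebra_simps)
      also have "\<dots> = ?t\<^sup>2" using circ by (simp add: cmod_power2)
      finally have "\<bar>(C + 1) * ?x\<bar> \<le> \<bar>?t\<bar>" by (simp add: abs_le_square_iff)
      moreover have "\<bar>?t\<bar> = sgn q * ?t"
        using tq by (auto simp: sgn_if zero_less_mult_iff)
      ultimately have "(C + 1) * ?x \<le> sgn q * ?t" by simp
      then have "C + 1 \<le> sgn q * (?t / ?x)" using x0 by (simp add: pos_le_divide_eq)
      then have "arctan (C + 1) \<le> arctan (sgn q * (?t / ?x))" by (simp only: arctan_le_iff)
      also have "\<dots> = sgn q * arctan (?t / ?x)" using sgnq arctan_minus[of "?t / ?x"] by auto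
      finally have "\<beta> y \<le> - L * ?x" by (simp add: \<beta>_def)
      then show ?thesis using mult_pos_pos[OF L x0] by simp
    next
      case False
      then have "\<rho>0\<^sup>2 \<le> (norm (\<zeta> y))\<^sup>2" using \<rho>0 by (intro power_mono) auto
      then have "L * (\<rho>0\<^sup>2 / 2) \<le> L * Re (\<zeta> y)" using L circ by (intro mult_left_mono) auto
      moreover have "L * (\<rho>0\<^sup>2 / 2) = pi" using \<rho>0 by (simp add: L_def)
      ultimately show ?thesis
        using arctan_bounded[of "C + 1"] arc_le[of "Im (\<zeta> y) / Re (\<zeta> y)"]
        unfolding \<beta>_def by linarith
    qed
  qed
  have \<beta>_harm: "harmonic_on \<beta> (\<Omega> i)"
  proof (rule harmonic_on_cong[OF _ open_disk])
    show "harmonic_on (\<lambda>z. Re (of_real (arctan (C + 1)) + \<i> * of_real (sgn q) * Ln (\<zeta> z) - of_real L * \<zeta> z)) (\<Omega> i)"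
      unfolding \<zeta>_def
      by (intro harmonic_on_Re_holomorphic holomorphic_intros holomorphic_on_Ln_halfplane open_disk)
        (use cP Re_in in \<open>auto simp: \<zeta>_def\<close>)
    fix z assume "z \<in> \<Omega> i"
    from Re_in[OF this] show "Re (of_real (arctan (C + 1)) + \<i> * of_real (sgn q) * Ln (\<zeta> z) - of_real L * \<zeta> z) = \<beta> z"
      using Im_Ln_eq[of "\<zeta> z"] by (cases "\<zeta> z = 0") (auto simp: \<beta>_def)
  qed
  have \<beta>_bd: "\<bar>\<beta> z\<bar> \<le> 4 + 2 * L" if "z \<in> \<Omega> i" for z
  proof -
    have "dist z P < 2 * r i" using that cP(2) dist_triangle[of z P "c i"] by (simp add: disk_def dist_commute)
    then have "norm (\<zeta> z) \<le> 2" unfolding n\<zeta> using ri by (simp add: pos_divide_le_eq)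
    then have "L * Re (\<zeta> z) \<le> L * 2" using L complex_Re_le_cmod[of "\<zeta> z"] by (intro mult_left_mono) auto
    then show ?thesis
      using \<beta>_le[OF Re_in[OF that]] arctan_bounded[of "C + 1"] arc_le[of "Im (\<zeta> z) / Re (\<zeta> z)"] pi_less_4 L
      unfolding \<beta>_def by linarith
  qed
  have \<beta>_cont: "isCont \<beta> y" if "y \<in> frontier (\<Omega> i)" "y \<noteq> P" for y
    unfolding \<beta>_def \<zeta>_def using Re_fr[OF that] cP(1)
    by (intro continuous_intros) (auto simp: \<zeta>_def)
  have upper: "\<bar>w i x\<bar> \<le> K * (\<alpha> i x - \<beta> x / 4)" if K: "K \<ge> 0" "dominated K w" and x: "x \<in> \<Omega> i" for K w x
  proof (rule dominated_comparison[OF K(2) i, where F = "{P}"])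
    show "harmonic_on (\<lambda>x. K * (\<alpha> i x - \<beta> x / 4)) (\<Omega> i)"
      using harmonic_on_cmult[OF harmonic_on_diff[OF \<alpha>_harmonic harmonic_on_cmult[OF \<beta>_harm, of "1/4"]], of K]
      by simp
    obtain A where A: "\<And>z. z \<in> \<Omega> i \<Longrightarrow> \<bar>\<alpha> i z\<bar> \<le> A"
      using \<alpha>_bounded[of i] unfolding bounded_iff by auto
    have "\<bar>K * (\<alpha> i z - \<beta> z / 4)\<bar> \<le> K * (A + (4 + 2 * L))" if "z \<in> \<Omega> i" for z
      unfolding abs_mult using K(1) A[OF that] \<beta>_bd[OF that]
      by (intro mult_mono) (auto simp: abs_le_iff)
    then show "bounded ((\<lambda>x. K * (\<alpha> i x - \<beta> x / 4)) ` \<Omega> i)" unfolding bounded_iff by auto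
    fix y assume y: "y \<in> frontier (\<Omega> i) - {P}"
    have "isCont (\<alpha> i) y" using \<alpha>_continuous[of UNIV i] continuous_on_eq_continuous_at open_UNIV by blast
    then have "isCont (\<lambda>x. K * (\<alpha> i x - \<beta> x / 4)) y" using \<beta>_cont[of y] y
      by (intro continuous_intros) auto
    then have "((\<lambda>x. K * (\<alpha> i x - \<beta> x / 4)) \<longlongrightarrow> K * (\<alpha> i y - \<beta> y / 4)) (at y within \<Omega> i)"
      unfolding isCont_def by (rule tendsto_within_subset) simp
    moreover have "(if y \<in> Ext i then 0 else K * \<phi> y) \<le> K * (\<alpha> i y - \<beta> y / 4)"
    proof (cases "y \<in> Ext i")
      case True
      have "1 \<le> \<phi> y" using y closure_disk_subset[OF i] by (intro \<phi>_bounds) (auto simp: frontier_def)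
      then have "0 \<le> \<alpha> i y - \<beta> y / 4"
        using \<beta>_le[OF Re_fr[of y]] y \<alpha>_eq_frontier[OF i, of y] by auto
      then show ?thesis using True K(1) by simp
    next
      case False
      then have "\<phi> y \<le> \<alpha> i y - \<beta> y / 4" using \<beta>_int[of y] y \<alpha>_eq_frontier[OF i, of y] by auto
      then show ?thesis using False K(1) by (simp add: mult_left_mono)
    qed
    ultimately show "\<exists>l. ((\<lambda>x. K * (\<alpha> i x - \<beta> x / 4)) \<longlongrightarrow> l) (at y within \<Omega> i) \<and>
       (if y \<in> Ext i then 0 else K * \<phi> y) \<le> l" by blast
  qed (use x in auto)
  define \<delta> where "\<delta> = arctan (C + 1) - arctan C"
  have \<delta>: "\<delta> > 0" by (simp add: \<delta>_def arctan_less_iff)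
  show thesis
  proof (rule that[of "r i * (\<delta> / (2 * L))" "\<delta> / 8"])
    show "0 < r i * (\<delta> / (2 * L))" "0 < \<delta> / 8" using ri \<delta> L by auto
    fix K w x assume K: "K \<ge> 0" "dominated K w" and x: "x \<in> frontier (\<Omega> j) \<inter> \<Omega> i" and d: "dist x P < r i * (\<delta> / (2 * L))"
    have x0: "Re (\<zeta> x) > 0" using Re_in x by blast
    have "\<bar>Im (\<zeta> x)\<bar> \<le> C * Re (\<zeta> x)"
      using crossing_circle_cone[OF Pi Pj ri nbr_circles_transversal[OF i j P(1,2)], of x] x frontier_disk[OF jN]
      unfolding C_def p_def q_def \<zeta>_def disk_def by blast
    then have "sgn q * Im (\<zeta> x) \<le> C * Re (\<zeta> x)" using sgnq by auto
    then have "sgn q * (Im (\<zeta> x) / Re (\<zeta> x)) \<le> C" using x0 by (simp add: pos_divide_le_eq)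
    then have "arctan (sgn q * (Im (\<zeta> x) / Re (\<zeta> x))) \<le> arctan C" by (simp only: arctan_le_iff)
    moreover have "arctan (sgn q * (Im (\<zeta> x) / Re (\<zeta> x))) = sgn q * arctan (Im (\<zeta> x) / Re (\<zeta> x))"
      using sgnq arctan_minus[of "Im (\<zeta> x) / Re (\<zeta> x)"] by auto
    moreover have "L * Re (\<zeta> x) \<le> \<delta> / 2"
    proof -
      have "norm (\<zeta> x) \<le> \<delta> / (2 * L)" unfolding n\<zeta> using d ri by (simp add: pos_divide_le_eq mult.commute)
      then have "L * Re (\<zeta> x) \<le> L * (\<delta> / (2 * L))"
        using L complex_Re_le_cmod[of "\<zeta> x"] by (intro mult_left_mono) auto
      then show ?thesis using L by simp
    qed
    moreover have "\<beta> x = \<delta> + arctan C - sgn q * arctan (Im (\<zeta> x) / Re (\<zeta> x)) - L * Re (\<zeta> x)"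
      by (simp add: \<beta>_def \<delta>_def)
    ultimately have "\<delta> / 2 \<le> \<beta> x" by linarith
    then have "K * (\<alpha> i x - \<beta> x / 4) \<le> K * (\<alpha> i x - \<delta> / 8)" using K(1) by (intro mult_left_mono) auto
    then show "\<bar>w i x\<bar> \<le> K * (\<alpha> i x - \<delta> / 8)" using upper[OF K, of x] x by auto
  qed
qed

end

section \<open>Contraction across the interfaces\<close>

lemma compact_imp_uniform_lt_one:
  fixes S :: "'a::topological_space set" and Q :: "real \<Rightarrow> 'a \<Rightarrow> bool"
  assumes "compact S"
    and loc: "\<And>P. P \<in> S \<Longrightarrow> \<exists>\<theta><1. \<forall>\<^sub>F x in nhds P. Q \<theta> x"
    and mono: "\<And>\<theta> \<theta>' x. Q \<theta> x \<Longrightarrow> \<theta> \<le> \<theta>' \<Longrightarrow> Q \<theta>' x"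
  shows "\<exists>\<theta><1. 0 \<le> \<theta> \<and> (\<forall>x\<in>S. Q \<theta> x)"
proof -
  have "\<exists>\<theta> V. \<theta> < 1 \<and> open V \<and> P \<in> V \<and> (\<forall>x\<in>V. Q \<theta> x)" if "P \<in> S" for P
    using loc[OF that] unfolding eventually_nhds by blast
  then obtain \<theta> V where V: "\<And>P. P \<in> S \<Longrightarrow> \<theta> P < 1" "\<And>P. P \<in> S \<Longrightarrow> open (V P)"
      "\<And>P. P \<in> S \<Longrightarrow> P \<in> V P" "\<And>P x. P \<in> S \<Longrightarrow> x \<in> V P \<Longrightarrow> Q (\<theta> P) x"
    by metis
  obtain T where T: "T \<subseteq> S" "finite T" "S \<subseteq> (\<Union>P\<in>T. V P)"
    by (rule compactE_image[OF assms(1), of S V]) (use V(2,3) in auto)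
  define m where "m = Max (insert 0 (\<theta> ` T))"
  have "m < 1" "0 \<le> m" unfolding m_def using T(1,2) V(1) by (auto simp: subset_iff)
  moreover have "Q m x" if "x \<in> S" for x
  proof -
    obtain P where P: "P \<in> T" "x \<in> V P" using T(3) \<open>x \<in> S\<close> by auto
    then have "Q (\<theta> P) x" using V(4) T(1) by blast
    moreover have "\<theta> P \<le> m" unfolding m_def using T(2) P(1) by simp
    ultimately show ?thesis by (rule mono)
  qed
  ultimately show ?thesis by blast
qed

context disk_partition
begin

definition interface_bound :: "nat \<Rightarrow> real \<Rightarrow> complex \<Rightarrow> bool" where
  "interface_bound j \<theta> x \<longleftrightarrow> (x \<in> frontier (\<Omega> j) - Ext j \<longrightarrow>
     (\<forall>K w. K \<ge> 0 \<longrightarrow> dominated K w \<longrightarrow> (\<Sum>i\<in>Nb j. chi j i x * \<bar>w i x\<bar>) \<le> \<theta> * K * \<phi> x))"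

lemma \<phi>_ge_1_frontier: "j \<in> {1..N} \<Longrightarrow> x \<in> frontier (\<Omega> j) \<Longrightarrow> 1 \<le> \<phi> x"
  using closure_disk_subset by (intro \<phi>_bounds) (auto simp: frontier_def)

lemma interface_bound_mono:
  assumes "j \<in> {1..N}" "interface_bound j \<theta> x" "\<theta> \<le> \<theta>'"
  shows "interface_bound j \<theta>' x"
  unfolding interface_bound_def
proof (intro impI allI)
  fix K w assume x: "x \<in> frontier (\<Omega> j) - Ext j" and K: "(0::real) \<le> K" "dominated K w"
  have "1 \<le> \<phi> x" using \<phi>_ge_1_frontier[OF assms(1)] x by blast
  then have "\<theta> * K * \<phi> x \<le> \<theta>' * K * \<phi> x"
    using K(1) assms(3) by (intro mult_right_mono) auto
  then show "(\<Sum>i\<in>Nb j. chi j i x * \<bar>w i x\<bar>) \<le> \<theta>' * K * \<phi> x"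
    using assms(2) x K unfolding interface_bound_def by (meson order_trans)
qed

text \<open>A disk \<open>\<Omega>\<^sub>i\<close> that contains interface points of \<open>\<Omega>\<^sub>j\<close> close to \<open>P\<close> has \<open>P\<close> on its boundary, so the barrier at \<open>P\<close>
provides a definite gain for each term, and the weights \<open>\<chi>\<^sub>j\<^sup>i\<close> average these gains.\<close>

lemma interface_bound_near_corner:
  assumes j: "j \<in> {1..N}" and P: "P \<in> Ext j"
  shows "\<exists>\<theta><1. \<forall>\<^sub>F x in nhds P. interface_bound j \<theta> x"
proof -
  have PD: "P \<notin> Dom" and Pj: "P \<in> frontier (\<Omega> j)"
    using P open_domain by (auto simp: ext_bd_def frontier_def interior_open)
  have "\<exists>\<theta><1. \<forall>\<^sub>F x in nhds P. x \<in> frontier (\<Omega> j) \<inter> \<Omega> i \<longrightarrow>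
     (\<forall>K w. K \<ge> 0 \<longrightarrow> dominated K w \<longrightarrow> \<bar>w i x\<bar> \<le> \<theta> * K * \<phi> x)" if i: "i \<in> Nb j" for i
  proof (cases "P \<in> frontier (\<Omega> i)")
    case True
    have iN: "i \<in> {1..N}" using nbrsD[OF i] by blast
    have ji: "j \<in> Nb i" using nbrs_sym[OF j i] .
    obtain \<rho> \<eta> where \<rho>: "\<rho> > 0" "\<eta> > 0"
      "\<And>K w x. K \<ge> 0 \<Longrightarrow> dominated K w \<Longrightarrow> x \<in> frontier (\<Omega> j) \<inter> \<Omega> i \<Longrightarrow> dist x P < \<rho> \<Longrightarrow>
       \<bar>w i x\<bar> \<le> K * (\<alpha> i x - \<eta>)"
      using corner_barrier[OF iN ji True Pj PD] by blast
    define \<theta> where "\<theta> = 1 - \<eta> / (1 + rad\<^sup>2)"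
    have R: "1 + rad\<^sup>2 > 0" by (simp add: add_pos_nonneg)
    have near: "\<bar>w i x\<bar> \<le> \<theta> * K * \<phi> x"
      if "dist x P < \<rho>" "x \<in> frontier (\<Omega> j) \<inter> \<Omega> i" "K \<ge> 0" "dominated K w" for x K w
    proof -
      have "\<eta> * \<phi> x \<le> \<eta> * (1 + rad\<^sup>2)" using \<rho>(2) \<phi>_bounds(2) by (intro mult_left_mono) auto
      then have "\<eta> / (1 + rad\<^sup>2) * \<phi> x \<le> \<eta>" using R by (simp add: pos_divide_le_eq)
      moreover have "\<alpha> i x < \<phi> x" using \<alpha>_less_inside that(2) by blast
      ultimately have "\<alpha> i x - \<eta> \<le> \<theta> * \<phi> x" by (simp add: \<theta>_def left_diff_distrib)
      then have "K * (\<alpha> i x - \<eta>) \<le> K * (\<theta> * \<phi> x)" using that(3) by (rule mult_left_mono)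
      then show ?thesis using \<rho>(3)[OF that(3,4,2,1)] by (simp add: mult_ac)
    qed
    have "\<theta> < 1" using \<rho>(2) R by (simp add: \<theta>_def)
    moreover have "\<forall>\<^sub>F x in nhds P. dist x P < \<rho>" using \<rho>(1) eventually_nhds_metric by blast
    then have "\<forall>\<^sub>F x in nhds P. x \<in> frontier (\<Omega> j) \<inter> \<Omega> i \<longrightarrow>
     (\<forall>K w. K \<ge> 0 \<longrightarrow> dominated K w \<longrightarrow> \<bar>w i x\<bar> \<le> \<theta> * K * \<phi> x)"
      by eventually_elim (use near in blast)
    ultimately show ?thesis by blast
  next
    case False
    have "P \<notin> \<Omega> i" using ext_not_in_disk[OF P] nbrsD[OF i] by blast
    then have "P \<in> - closure (\<Omega> i)" using False by (simp add: frontier_def interior_open)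
    then have "\<forall>\<^sub>F x in nhds P. x \<in> - closure (\<Omega> i)" by (intro eventually_nhds_in_open) auto
    then have "\<forall>\<^sub>F x in nhds P. x \<in> frontier (\<Omega> j) \<inter> \<Omega> i \<longrightarrow>
     (\<forall>K w. K \<ge> 0 \<longrightarrow> dominated K w \<longrightarrow> \<bar>w i x\<bar> \<le> 0 * K * \<phi> x)"
      by eventually_elim (use closure_subset[of "\<Omega> i"] in blast)
    then show ?thesis by (intro exI[of _ 0]) simp
  qed
  then have "\<forall>i\<in>Nb j. \<exists>\<theta>. \<theta> < 1 \<and> (\<forall>\<^sub>F x in nhds P. x \<in> frontier (\<Omega> j) \<inter> \<Omega> i \<longrightarrow>
     (\<forall>K w. K \<ge> 0 \<longrightarrow> dominated K w \<longrightarrow> \<bar>w i x\<bar> \<le> \<theta> * K * \<phi> x))"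
    by (intro ballI)
  from bchoice[OF this] obtain \<theta> where \<theta>: "\<forall>i\<in>Nb j. \<theta> i < 1 \<and>
     (\<forall>\<^sub>F x in nhds P. x \<in> frontier (\<Omega> j) \<inter> \<Omega> i \<longrightarrow>
     (\<forall>K w. K \<ge> 0 \<longrightarrow> dominated K w \<longrightarrow> \<bar>w i x\<bar> \<le> \<theta> i * K * \<phi> x))"
    by (elim exE)
  define m where "m = Max (insert 0 (\<theta> ` Nb j))"
  have m: "m < 1" "\<And>i. i \<in> Nb j \<Longrightarrow> \<theta> i \<le> m" using \<theta> by (auto simp: m_def)
  have "\<forall>\<^sub>F x in nhds P. \<forall>i\<in>Nb j. x \<in> frontier (\<Omega> j) \<inter> \<Omega> i \<longrightarrow>
     (\<forall>K w. K \<ge> 0 \<longrightarrow> dominated K w \<longrightarrow> \<bar>w i x\<bar> \<le> \<theta> i * K * \<phi> x)"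
    using \<theta> by (intro eventually_ball_finite finite_nbrs ballI) (drule (1) bspec, elim conjE)
  then have "\<forall>\<^sub>F x in nhds P. interface_bound j m x"
  proof eventually_elim
    case (elim x)
    show ?case
      unfolding interface_bound_def
    proof (intro impI allI)
      fix K w assume x: "x \<in> frontier (\<Omega> j) - Ext j" and K: "(0::real) \<le> K" "dominated K w"
      have \<phi>1: "1 \<le> \<phi> x" using \<phi>_ge_1_frontier[OF j] x by blast
      have xI: "x \<in> Int_bd j" using x Int_bd_eq[OF j] by blast
      have "chi j i x * \<bar>w i x\<bar> \<le> chi j i x * (m * K * \<phi> x)" if i: "i \<in> Nb j" for i
      proof (cases "x \<in> \<Omega> i")
        case True
        then have "\<bar>w i x\<bar> \<le> \<theta> i * K * \<phi> x" using elim i x K by blast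
        also have "\<dots> \<le> m * K * \<phi> x" using m(2)[OF i] K(1) \<phi>1 by (intro mult_right_mono) auto
        finally show ?thesis using chi_nonneg[OF j i x] by (rule mult_left_mono)
      next
        case False
        then show ?thesis using chi_eq_0_outside[OF j i xI] by simp
      qed
      then have "(\<Sum>i\<in>Nb j. chi j i x * \<bar>w i x\<bar>) \<le> (\<Sum>i\<in>Nb j. chi j i x * (m * K * \<phi> x))"
        by (rule sum_mono)
      also have "\<dots> = m * K * \<phi> x" using chi_sum[OF j xI] by (simp add: sum_distrib_right[symmetric])
      finally show "(\<Sum>i\<in>Nb j. chi j i x * \<bar>w i x\<bar>) \<le> m * K * \<phi> x" .
    qed
  qed
  then show ?thesis using m(1) by blast
qed

text \<open>The weighted mean of the \<open>\<alpha>\<^sub>i / \<phi>\<close> is continuous on the interface and smaller than \<open>1\<close> at \<open>P\<close>, since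
every \<open>i\<close> with positive weight at \<open>P\<close> has \<open>P \<in> \<Omega>\<^sub>i\<close>.\<close>

lemma interface_bound_near_interior:
  assumes j: "j \<in> {1..N}" and P: "P \<in> frontier (\<Omega> j) - Ext j"
  shows "\<exists>\<theta><1. \<forall>\<^sub>F x in nhds P. interface_bound j \<theta> x"
proof -
  define f where "f = (\<lambda>x. (\<Sum>i\<in>Nb j. chi j i x * \<alpha> i x) / \<phi> x)"
  let ?T = "frontier (\<Omega> j) - Ext j"
  have \<phi>1: "1 \<le> \<phi> x" if "x \<in> ?T" for x using \<phi>_ge_1_frontier[OF j] that by blast
  have cont: "continuous_on ?T f"
    unfolding f_def
  proof (intro continuous_intros)
    show "continuous_on ?T (chi j i)" if "i \<in> Nb j" for i
      using chi_continuous[OF j that] unfolding Int_bd_eq[OF j] .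
    show "continuous_on ?T \<phi>" unfolding \<phi>_def by (intro continuous_intros)
    show "\<forall>x\<in>?T. \<phi> x \<noteq> 0" using \<phi>1 by force
  qed
  have PI: "P \<in> Int_bd j" using P Int_bd_eq[OF j] by blast
  have "f P < 1"
  proof -
    have le: "chi j i P * \<alpha> i P \<le> chi j i P * \<phi> P" if i: "i \<in> Nb j" for i
      using \<alpha>_less_inside[of P i] chi_nonneg[OF j i P] chi_eq_0_outside[OF j i PI]
      by (cases "P \<in> \<Omega> i") (auto intro: mult_left_mono)
    obtain k where k: "k \<in> Nb j" "chi j k P \<noteq> 0"
      using chi_sum[OF j PI] by (metis (mono_tags, lifting) sum.neutral zero_neq_one)
    then have "P \<in> \<Omega> k" using chi_eq_0_outside[OF j _ PI] by blast
    then have "chi j k P * \<alpha> k P < chi j k P * \<phi> P"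
      using \<alpha>_less_inside[of P k] chi_nonneg[OF j k(1) P] k(2) by (intro mult_strict_left_mono) auto
    then have "(\<Sum>i\<in>Nb j. chi j i P * \<alpha> i P) < (\<Sum>i\<in>Nb j. chi j i P * \<phi> P)"
      using le k(1) by (intro sum_strict_mono_ex1) auto
    also have "\<dots> = \<phi> P" using chi_sum[OF j PI] by (simp add: sum_distrib_right[symmetric])
    finally show ?thesis using \<phi>1[OF P] by (simp add: f_def)
  qed
  define \<theta> where "\<theta> = (1 + f P) / 2"
  have \<theta>: "\<theta> < 1" "f P < \<theta>" using \<open>f P < 1\<close> by (auto simp: \<theta>_def)
  then obtain d where d: "d > 0" "\<And>x. x \<in> ?T \<Longrightarrow> dist x P < d \<Longrightarrow> dist (f x) (f P) < \<theta> - f P"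
    using cont P unfolding continuous_on_iff by (meson diff_gt_0_iff_gt)
  have "\<forall>\<^sub>F x in nhds P. dist x P < d" using d(1) eventually_nhds_metric by blast
  then have "\<forall>\<^sub>F x in nhds P. interface_bound j \<theta> x"
  proof eventually_elim
    case (elim x)
    show ?case
      unfolding interface_bound_def
    proof (intro impI allI)
      fix K w assume x: "x \<in> ?T" and K: "(0::real) \<le> K" "dominated K w"
      have xI: "x \<in> Int_bd j" using x Int_bd_eq[OF j] by blast
      have "f x \<le> \<theta>" using d(2)[OF x elim] by (simp add: dist_real_def)
      then have f\<theta>: "(\<Sum>i\<in>Nb j. chi j i x * \<alpha> i x) \<le> \<theta> * \<phi> x"
        using \<phi>1[OF x] by (simp add: f_def pos_divide_le_eq)
      have "chi j i x * \<bar>w i x\<bar> \<le> K * (chi j i x * \<alpha> i x)" if i: "i \<in> Nb j" for i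
      proof (cases "x \<in> \<Omega> i")
        case True
        have iN: "i \<in> {1..N}" using nbrsD[OF i] by blast
        have "chi j i x * \<bar>w i x\<bar> \<le> chi j i x * (K * \<alpha> i x)"
          using dominated_le_\<alpha>[OF K(2,1) iN True] chi_nonneg[OF j i x] by (rule mult_left_mono)
        then show ?thesis by (simp add: mult_ac)
      next
        case False
        then show ?thesis using chi_eq_0_outside[OF j i xI] by simp
      qed
      then have "(\<Sum>i\<in>Nb j. chi j i x * \<bar>w i x\<bar>) \<le> K * (\<Sum>i\<in>Nb j. chi j i x * \<alpha> i x)"
        unfolding sum_distrib_left by (rule sum_mono)
      also have "\<dots> \<le> K * (\<theta> * \<phi> x)" using f\<theta> K(1) by (rule mult_left_mono)
      finally show "(\<Sum>i\<in>Nb j. chi j i x * \<bar>w i x\<bar>) \<le> \<theta> * K * \<phi> x" by (simp add: mult_ac)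
    qed
  qed
  then show ?thesis using \<theta>(1) by blast
qed

lemma interface_contraction:
  obtains \<theta> where "0 \<le> \<theta>" "\<theta> < 1"
    "\<And>j K w x. j \<in> {1..N} \<Longrightarrow> x \<in> frontier (\<Omega> j) - Ext j \<Longrightarrow> K \<ge> 0 \<Longrightarrow> dominated K w \<Longrightarrow>
       (\<Sum>i\<in>Nb j. chi j i x * \<bar>w i x\<bar>) \<le> \<theta> * K * \<phi> x"
proof -
  have "\<exists>\<theta><1. 0 \<le> \<theta> \<and> (\<forall>x\<in>int_bd N c r j. interface_bound j \<theta> x)" if j: "j \<in> {1..N}" for j
  proof (rule compact_imp_uniform_lt_one)
    have sub: "int_bd N c r j \<subseteq> frontier (\<Omega> j)"
      unfolding int_bd_def by (rule closure_minimal) auto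
    moreover have "compact (frontier (\<Omega> j))" unfolding frontier_disk[OF j] by (rule compact_sphere)
    ultimately show "compact (int_bd N c r j)"
      using compact_Int_closed[of "frontier (\<Omega> j)" "int_bd N c r j"] by (simp add: int_bd_def inf.absorb2)
    show "\<exists>\<theta><1. \<forall>\<^sub>F x in nhds P. interface_bound j \<theta> x" if "P \<in> int_bd N c r j" for P
      using interface_bound_near_corner[OF j, of P] interface_bound_near_interior[OF j, of P] sub that by blast
  qed (rule interface_bound_mono[OF j])
  then obtain \<theta> where \<theta>: "\<And>j. j \<in> {1..N} \<Longrightarrow> \<theta> j < 1" "\<And>j. j \<in> {1..N} \<Longrightarrow> 0 \<le> \<theta> j"
     "\<And>j x. j \<in> {1..N} \<Longrightarrow> x \<in> int_bd N c r j \<Longrightarrow> interface_bound j (\<theta> j) x"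
    by metis
  define m where "m = Max (insert 0 (\<theta> ` {1..N}))"
  show thesis
  proof (rule that[of m])
    show "0 \<le> m" "m < 1" using \<theta>(1) by (auto simp: m_def)
    fix j K w x assume j: "j \<in> {1..N}" and x: "x \<in> frontier (\<Omega> j) - Ext j" and K: "(0::real) \<le> K" "dominated K w"
    have "\<theta> j \<le> m" unfolding m_def using j by (intro Max_ge) auto
    moreover have "x \<in> int_bd N c r j" unfolding int_bd_def by (rule subsetD[OF closure_subset x])
    ultimately have "interface_bound j m x" using interface_bound_mono[OF j \<theta>(3)[OF j]] by blast
    then show "(\<Sum>i\<in>Nb j. chi j i x * \<bar>w i x\<bar>) \<le> m * K * \<phi> x"
      unfolding interface_bound_def using x K by blast
  qed
qed

end

section \<open>Errors of the Schwarz iteration\<close>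

context disk_partition
begin

lemma error_solves_local:
  assumes u: "solves_global N c r g u" and j: "j \<in> {1..N}" and w: "solves_local N c r chi g j v w"
  shows "solves_local N c r chi (\<lambda>_. 0) j (\<lambda>i x. u x - v i x) (\<lambda>x. u x - w x)"
proof -
  have uh: "harmonic_on u Dom" and ub: "bounded (u ` Dom)"
    and uF: "finite {x \<in> frontier Dom. \<not> (u \<longlongrightarrow> g x) (at x within Dom)}"
    using u by (auto simp: solves_global_def bounded_harmonic_on_def dirichlet_on_def)
  have wh: "harmonic_on w (\<Omega> j)" and wb: "bounded (w ` \<Omega> j)"
    and wF1: "finite {x \<in> Ext j. \<not> (w \<longlongrightarrow> g x) (at x within \<Omega> j)}"
    and wF2: "finite {x \<in> frontier (\<Omega> j) - Ext j. \<not> (w \<longlongrightarrow> (\<Sum>i\<in>Nb j. v i x * chi j i x)) (at x within \<Omega> j)}"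
    using w by (auto simp: solves_local_def bounded_harmonic_on_def dirichlet_on_def)
  have sub: "\<Omega> j \<subseteq> Dom" using disk_subset_domain[OF j] .
  show ?thesis
    unfolding solves_local_def bounded_harmonic_on_def dirichlet_on_def
  proof (intro conjI)
    show "harmonic_on (\<lambda>x. u x - w x) (\<Omega> j)"
      by (intro harmonic_on_diff harmonic_on_subset[OF uh sub] wh)
    show "bounded ((\<lambda>x. u x - w x) ` \<Omega> j)"
      by (intro bounded_minus_comp wb bounded_subset[OF ub image_mono[OF sub]])
    show "finite {x \<in> Ext j. \<not> ((\<lambda>x. u x - w x) \<longlongrightarrow> 0) (at x within \<Omega> j)}"
    proof (rule finite_subset[OF _ finite_UnI[OF uF wF1]], rule subsetI, rule ccontr)
      fix x assume x: "x \<in> {x \<in> Ext j. \<not> ((\<lambda>x. u x - w x) \<longlongrightarrow> 0) (at x within \<Omega> j)}"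
        and nin: "x \<notin> {x \<in> frontier Dom. \<not> (u \<longlongrightarrow> g x) (at x within Dom)} \<union>
          {x \<in> Ext j. \<not> (w \<longlongrightarrow> g x) (at x within \<Omega> j)}"
      have "x \<in> frontier Dom" using x by (simp add: ext_bd_def)
      then have "(u \<longlongrightarrow> g x) (at x within Dom)" and wg: "(w \<longlongrightarrow> g x) (at x within \<Omega> j)"
        using nin x by auto
      from tendsto_diff[OF tendsto_within_subset[OF this(1) sub] wg]
      have "((\<lambda>x. u x - w x) \<longlongrightarrow> g x - g x) (at x within \<Omega> j)" .
      then show False using x by simp
    qed
    show "finite {x \<in> frontier (\<Omega> j) - Ext j. \<not> ((\<lambda>x. u x - w x) \<longlongrightarrow>
        (\<Sum>i\<in>Nb j. (u x - v i x) * chi j i x)) (at x within \<Omega> j)}"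
    proof (rule finite_subset[OF _ wF2], rule subsetI, rule ccontr)
      fix x assume x: "x \<in> {x \<in> frontier (\<Omega> j) - Ext j. \<not> ((\<lambda>x. u x - w x) \<longlongrightarrow>
        (\<Sum>i\<in>Nb j. (u x - v i x) * chi j i x)) (at x within \<Omega> j)}"
        and nin: "x \<notin> {x \<in> frontier (\<Omega> j) - Ext j.
          \<not> (w \<longlongrightarrow> (\<Sum>i\<in>Nb j. v i x * chi j i x)) (at x within \<Omega> j)}"
      have xE: "x \<in> frontier (\<Omega> j) - Ext j" using x by blast
      have w': "(w \<longlongrightarrow> (\<Sum>i\<in>Nb j. v i x * chi j i x)) (at x within \<Omega> j)" using nin xE by blast
      have "x \<in> Dom" using xE frontier_minus_ext[OF j] by blast
      then have "isCont u x"
        using harmonic_on_imp_continuous_on[OF uh] open_domain continuous_on_eq_continuous_at by blast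
      then have "(u \<longlongrightarrow> u x) (at x within \<Omega> j)"
        unfolding isCont_def by (rule tendsto_within_subset) simp
      then have "((\<lambda>x. u x - w x) \<longlongrightarrow> u x - (\<Sum>i\<in>Nb j. v i x * chi j i x)) (at x within \<Omega> j)"
        using w' by (rule tendsto_diff)
      moreover have "(\<Sum>i\<in>Nb j. (u x - v i x) * chi j i x) = u x - (\<Sum>i\<in>Nb j. v i x * chi j i x)"
        using chi_sum[OF j, of x] xE Int_bd_eq[OF j]
        by (simp add: left_diff_distrib sum_subtractf sum_distrib_left[symmetric])
      ultimately show False using x by simp
    qed
  qed
qed

text \<open>Where \<open>restrict\<close> replaces \<open>u\<close> by \<open>undefined\<close>, the factor \<open>\<chi>\<^sub>j\<^sup>i\<close> vanishes, so that the interface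
data reduce to \<open>u \<Sum>\<^sub>i \<chi>\<^sub>j\<^sup>i = u\<close>.\<close>

lemma restriction_solves_decomposed:
  assumes u: "solves_global N c r g u"
  shows "solves_decomposed N c r chi g (\<lambda>j. restrict u (\<Omega> j))"
  unfolding solves_decomposed_def
proof
  fix j assume j: "j \<in> {1..N}"
  have uh: "harmonic_on u Dom" and ub: "bounded (u ` Dom)"
    and uF: "finite {x \<in> frontier Dom. \<not> (u \<longlongrightarrow> g x) (at x within Dom)}"
    using u by (auto simp: solves_global_def bounded_harmonic_on_def dirichlet_on_def)
  have sub: "\<Omega> j \<subseteq> Dom" using disk_subset_domain[OF j] .
  have lim: "(restrict u (\<Omega> j) \<longlongrightarrow> l) (at x within \<Omega> j) \<longleftrightarrow> (u \<longlongrightarrow> l) (at x within \<Omega> j)" for l x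
    by (intro filterlim_cong refl) (simp add: eventually_at_filter)
  show "solves_local N c r chi g j (\<lambda>j. restrict u (\<Omega> j)) (restrict u (\<Omega> j))"
    unfolding solves_local_def bounded_harmonic_on_def dirichlet_on_def lim
  proof (intro conjI)
    show "harmonic_on (restrict u (\<Omega> j)) (\<Omega> j)"
      by (rule harmonic_on_cong[OF harmonic_on_subset[OF uh sub]]) auto
    show "bounded (restrict u (\<Omega> j) ` \<Omega> j)"
      using bounded_subset[OF ub image_mono[OF sub]] by simp
    show "finite {x \<in> Ext j. \<not> (u \<longlongrightarrow> g x) (at x within \<Omega> j)}"
      by (rule finite_subset[OF _ uF]) (auto simp: ext_bd_def intro: tendsto_within_subset[OF _ sub])
    have "(u \<longlongrightarrow> (\<Sum>i\<in>Nb j. restrict u (\<Omega> i) x * chi j i x)) (at x within \<Omega> j)"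
      if xE: "x \<in> frontier (\<Omega> j) - Ext j" for x
    proof -
      have "x \<in> Dom" using xE frontier_minus_ext[OF j] by blast
      then have "isCont u x"
        using harmonic_on_imp_continuous_on[OF uh] open_domain continuous_on_eq_continuous_at by blast
      then have "(u \<longlongrightarrow> u x) (at x within \<Omega> j)"
        unfolding isCont_def by (rule tendsto_within_subset) simp
      moreover have xI: "x \<in> Int_bd j" using xE Int_bd_eq[OF j] by blast
      have "(\<Sum>i\<in>Nb j. restrict u (\<Omega> i) x * chi j i x) = (\<Sum>i\<in>Nb j. u x * chi j i x)"
        using chi_eq_0_outside[OF j _ xI] by (intro sum.cong) (auto simp: restrict_def)
      then have "(\<Sum>i\<in>Nb j. restrict u (\<Omega> i) x * chi j i x) = u x"
        using chi_sum[OF j xI] by (simp add: sum_distrib_left[symmetric])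
      ultimately show ?thesis by simp
    qed
    then have "{x \<in> frontier (\<Omega> j) - Ext j.
      \<not> (u \<longlongrightarrow> (\<Sum>i\<in>Nb j. restrict u (\<Omega> i) x * chi j i x)) (at x within \<Omega> j)} = {}" by blast
    then show "finite {x \<in> frontier (\<Omega> j) - Ext j.
      \<not> (u \<longlongrightarrow> (\<Sum>i\<in>Nb j. restrict u (\<Omega> i) x * chi j i x)) (at x within \<Omega> j)}"
      by (rule ssubst) (rule finite.emptyI)
  qed
qed

lemma solves_local_imp_dominated:
  assumes w: "\<And>j. j \<in> {1..N} \<Longrightarrow> solves_local N c r chi (\<lambda>_. 0) j e (w j)"
    and e: "\<And>j x. j \<in> {1..N} \<Longrightarrow> x \<in> frontier (\<Omega> j) - Ext j \<Longrightarrow>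
      (\<Sum>i\<in>Nb j. chi j i x * \<bar>e i x\<bar>) \<le> K * \<phi> x"
  shows "dominated K w"
  unfolding dominated_def
proof
  fix j assume j: "j \<in> {1..N}"
  define F where "F = {x \<in> Ext j. \<not> (w j \<longlongrightarrow> 0) (at x within \<Omega> j)} \<union>
    {x \<in> frontier (\<Omega> j) - Ext j. \<not> (w j \<longlongrightarrow> (\<Sum>i\<in>Nb j. e i x * chi j i x)) (at x within \<Omega> j)}"
  have "finite F" and bh: "bounded_harmonic_on (w j) (\<Omega> j)"
    using w[OF j] by (auto simp: F_def solves_local_def dirichlet_on_def)
  moreover have "\<exists>l. (w j \<longlongrightarrow> l) (at y within \<Omega> j) \<and> \<bar>l\<bar> \<le> (if y \<in> Ext j then 0 else K * \<phi> y)"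
    if y: "y \<in> frontier (\<Omega> j) - F" for y
  proof (cases "y \<in> Ext j")
    case True
    then have "(w j \<longlongrightarrow> 0) (at y within \<Omega> j)" using y by (auto simp: F_def)
    then show ?thesis using True by (intro exI[of _ 0]) auto
  next
    case False
    then have yE: "y \<in> frontier (\<Omega> j) - Ext j" using y by blast
    have "\<bar>\<Sum>i\<in>Nb j. e i y * chi j i y\<bar> \<le> (\<Sum>i\<in>Nb j. \<bar>e i y * chi j i y\<bar>)" by (rule sum_abs)
    also have "\<dots> = (\<Sum>i\<in>Nb j. chi j i y * \<bar>e i y\<bar>)"
      using chi_nonneg[OF j _ yE] by (intro sum.cong) (auto simp: abs_mult)
    also have "\<dots> \<le> K * \<phi> y" by (rule e[OF j yE])
    finally have "\<bar>\<Sum>i\<in>Nb j. e i y * chi j i y\<bar> \<le> K * \<phi> y" .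
    moreover have "(w j \<longlongrightarrow> (\<Sum>i\<in>Nb j. e i y * chi j i y)) (at y within \<Omega> j)"
      using y yE unfolding F_def by blast
    ultimately show ?thesis using False by auto
  qed
  ultimately show "bounded_harmonic_on (w j) (\<Omega> j) \<and>
     (\<exists>F. finite F \<and> (\<forall>y\<in>frontier (\<Omega> j) - F. \<exists>l. (w j \<longlongrightarrow> l) (at y within \<Omega> j) \<and>
        \<bar>l\<bar> \<le> (if y \<in> Ext j then 0 else K * \<phi> y)))" by blast
qed

text \<open>At the start a plain bound for the errors suffices, as \<open>\<phi> \<ge> 1\<close> turns it into a weighted one; every
further step gains the factor \<open>\<theta>\<close>.\<close>

lemma error_geometric_decay:
  assumes W: "\<And>n j. j \<in> {1..N} \<Longrightarrow> solves_local N c r chi (\<lambda>_. 0) j (W n) (W (Suc n) j)"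
    and M: "\<And>j x. j \<in> {1..N} \<Longrightarrow> x \<in> \<Omega> j \<Longrightarrow> \<bar>W 0 j x\<bar> \<le> M"
  obtains \<theta> C where "0 \<le> \<theta>" "\<theta> < 1"
    "\<And>n j x. j \<in> {1..N} \<Longrightarrow> x \<in> \<Omega> j \<Longrightarrow> \<bar>W (Suc n) j x\<bar> \<le> C * \<theta> ^ n"
proof -
  obtain \<theta> where \<theta>: "0 \<le> \<theta>" "\<theta> < 1"
    "\<And>j K w x. j \<in> {1..N} \<Longrightarrow> x \<in> frontier (\<Omega> j) - Ext j \<Longrightarrow> K \<ge> 0 \<Longrightarrow> dominated K w \<Longrightarrow>
       (\<Sum>i\<in>Nb j. chi j i x * \<bar>w i x\<bar>) \<le> \<theta> * K * \<phi> x"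
    by (rule interface_contraction) iprover
  define M' where "M' = max M 0"
  have dom: "dominated (M' * \<theta> ^ n) (W (Suc n))" for n
  proof (induction n)
    case 0
    show ?case
    proof (rule solves_local_imp_dominated[OF W])
      fix j x assume j: "j \<in> {1..N}" and x: "x \<in> frontier (\<Omega> j) - Ext j"
      have xI: "x \<in> Int_bd j" using x Int_bd_eq[OF j] by blast
      have "chi j i x * \<bar>W 0 i x\<bar> \<le> chi j i x * M'" if i: "i \<in> Nb j" for i
      proof (cases "x \<in> \<Omega> i")
        case True
        then have "\<bar>W 0 i x\<bar> \<le> M'" using M[of i x] nbrsD[OF i] by (auto simp: M'_def)
        then show ?thesis using chi_nonneg[OF j i x] by (rule mult_left_mono)
      qed (use chi_eq_0_outside[OF j i xI] in simp)
      then have "(\<Sum>i\<in>Nb j. chi j i x * \<bar>W 0 i x\<bar>) \<le> (\<Sum>i\<in>Nb j. chi j i x * M')" by (rule sum_mono)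
      also have "\<dots> = M'" using chi_sum[OF j xI] by (simp add: sum_distrib_right[symmetric])
      also have "\<dots> \<le> M' * \<theta> ^ 0 * \<phi> x"
        using \<phi>_ge_1_frontier[OF j, of x] x by (simp add: mult_le_cancel_left1 M'_def)
      finally show "(\<Sum>i\<in>Nb j. chi j i x * \<bar>W 0 i x\<bar>) \<le> M' * \<theta> ^ 0 * \<phi> x" .
    qed
  next
    case (Suc n)
    have "0 \<le> M' * \<theta> ^ n" using \<theta>(1) by (simp add: M'_def)
    then show ?case
      using \<theta>(3)[OF _ _ _ Suc] by (intro solves_local_imp_dominated[OF W]) (simp_all add: mult_ac)
  qed
  have "\<bar>W (Suc n) j x\<bar> \<le> (M' * (1 + rad\<^sup>2)) * \<theta> ^ n" if j: "j \<in> {1..N}" and x: "x \<in> \<Omega> j" for n j x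
  proof -
    have K: "0 \<le> M' * \<theta> ^ n" using \<theta>(1) by (simp add: M'_def)
    have "\<alpha> j x \<le> 1 + rad\<^sup>2"
      using \<alpha>_less_inside[OF x] \<phi>_bounds(2)[of x] disk_subset_domain[OF j] x closure_subset[of Dom]
      by (meson less_imp_le order_trans subsetD)
    then have "M' * \<theta> ^ n * \<alpha> j x \<le> M' * \<theta> ^ n * (1 + rad\<^sup>2)" using K by (rule mult_left_mono)
    then show ?thesis using dominated_le_\<alpha>[OF dom K j x] by (simp add: mult_ac)
  qed
  then show thesis using that[OF \<theta>(1,2)] by blast
qed

lemma decomposed_unique:
  assumes u: "solves_global N c r g u" and v: "solves_decomposed N c r chi g v"
    and j: "j \<in> {1..N}" and x: "x \<in> \<Omega> j"
  shows "v j x = u x"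
proof -
  define e where "e = (\<lambda>i x. u x - v i x)"
  have v': "\<And>i. i \<in> {1..N} \<Longrightarrow> solves_local N c r chi g i v (v i)"
    using v by (simp add: solves_decomposed_def)
  have e: "solves_local N c r chi (\<lambda>_. 0) i e (e i)" if "i \<in> {1..N}" for i
    unfolding e_def by (rule error_solves_local[OF u that v'[OF that]])
  have "bounded (\<Union>i\<in>{1..N}. e i ` \<Omega> i)"
    using e by (intro bounded_UN) (auto simp: solves_local_def bounded_harmonic_on_def)
  then obtain M where M: "\<And>i x. i \<in> {1..N} \<Longrightarrow> x \<in> \<Omega> i \<Longrightarrow> \<bar>e i x\<bar> \<le> M"
    unfolding bounded_iff by fastforce
  obtain \<theta> C where \<theta>: "0 \<le> \<theta>" "\<theta> < 1"
    "\<And>n j x. j \<in> {1..N} \<Longrightarrow> x \<in> \<Omega> j \<Longrightarrow> \<bar>e j x\<bar> \<le> C * \<theta> ^ n"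
    by (rule error_geometric_decay[of "\<lambda>_. e", OF e M]) iprover+
  have "(\<lambda>n. C * \<theta> ^ n) \<longlonglongrightarrow> C * 0"
    using \<theta>(1,2) by (intro tendsto_intros LIMSEQ_power_zero) simp
  then have "\<bar>e j x\<bar> \<le> C * 0" using \<theta>(3)[OF j x] by (intro LIMSEQ_le_const) auto
  then show ?thesis by (simp add: e_def)
qed

end

section \<open>Arclength and the skeletons\<close>

lemma circle_measure_singleton:
  assumes "\<rho> > 0"
  shows "{x} \<in> null_sets (circle_measure a \<rho>)"
proof -
  let ?f = "\<lambda>t. a + complex_of_real \<rho> * cis t"
  have "countable (?f -` {x})"
  proof (cases "?f -` {x} = {}")
    case False
    then obtain t0 where t0: "?f t0 = x" by auto
    have "?f -` {x} \<subseteq> range (\<lambda>n::int. t0 + 2 * pi * n)"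
    proof
      fix t assume "t \<in> ?f -` {x}"
      then have "cis t = cis t0" using t0 assms by auto
      then have "sin t = sin t0 \<and> cos t = cos t0" by (simp add: complex_eq_iff)
      then show "t \<in> range (\<lambda>n::int. t0 + 2 * pi * n)" by (auto simp: sin_cos_eq_iff)
    qed
    then show ?thesis by (rule countable_subset) simp
  qed simp
  then have null: "emeasure lborel (?f -` {x} \<inter> {0..<2*pi}) = 0"
    by (intro emeasure_lborel_countable) auto
  have "continuous_on UNIV ?f" by (intro continuous_intros)
  then have m: "?f \<in> restrict_space lborel {0..<2*pi} \<rightarrow>\<^sub>M borel"
    by (intro measurable_restrict_space1) (simp add: borel_measurable_continuous_onI)
  have "emeasure (distr (restrict_space lborel {0..<2*pi}) borel ?f) {x} =
      emeasure (restrict_space lborel {0..<2*pi}) (?f -` {x} \<inter> {0..<2*pi})"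
    using m by (subst emeasure_distr) (auto simp: space_restrict_space)
  also have "\<dots> = emeasure lborel (?f -` {x} \<inter> {0..<2*pi})"
    by (rule emeasure_restrict_space) auto
  finally show ?thesis using null by (simp add: null_sets_def circle_measure_def)
qed

lemma circle_measure_finite_null:
  assumes "\<rho> > 0" "finite F"
  shows "F \<in> null_sets (circle_measure a \<rho>)"
  using assms(2)
proof (induction rule: finite_induct)
  case (insert x F)
  then show ?case using null_sets.Un[OF circle_measure_singleton[OF assms(1), of x a] insert.IH] by simp
qed simp

context overlapping_disks
begin

lemma arclength_finite_null:
  assumes "finite F"
  shows "F \<in> null_sets (arclength N c r)"
proof -
  have F: "F \<in> sets borel" using assms by (simp add: borel_closed finite_imp_closed)
  have "emeasure (circle_measure (c i) (r i)) F = 0" if "i \<in> {1..N}" for i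
    using circle_measure_finite_null[OF radius_pos[OF that] assms, of "c i"] by (simp add: null_sets_def)
  then have "emeasure (arclength N c r) F = 0" unfolding emeasure_arclength[OF F] by simp
  then show ?thesis using F by (simp add: null_sets_def)
qed

lemma closed_skeleton: "closed (skeleton N c r j)"
  unfolding skeleton_def skeleton_part_def by (intro closed_UN) auto

lemma skeleton_minus_disk_subset:
  assumes j: "j \<in> {1..N}"
  shows "skeleton N c r j - \<Omega> j \<subseteq> (\<Union>k\<in>Nb j. frontier (\<Omega> j) \<inter> frontier (\<Omega> k))"
proof
  fix x assume x: "x \<in> skeleton N c r j - \<Omega> j"
  then obtain k where k: "k \<in> Nb j" "x \<in> closure (\<Union>i \<in> common_nbrs0 N c r j k. arc N c r k j i)"
    by (auto simp: skeleton_def skeleton_part_def)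
  have "(\<Union>i \<in> common_nbrs0 N c r j k. arc N c r k j i) \<subseteq> frontier (\<Omega> k) \<inter> \<Omega> j"
    using arc_subset by (rule UN_least)
  then have "x \<in> closure (frontier (\<Omega> k) \<inter> \<Omega> j)" using k(2) closure_mono by blast
  also have "\<dots> \<subseteq> frontier (\<Omega> k) \<inter> closure (\<Omega> j)"
    by (intro closure_minimal closed_Int) (auto simp: closure_subset[THEN subsetD])
  finally have "x \<in> frontier (\<Omega> k)" "x \<in> closure (\<Omega> j)" by auto
  then show "x \<in> (\<Union>k\<in>Nb j. frontier (\<Omega> j) \<inter> frontier (\<Omega> k))"
    using x k(1) by (auto simp: frontier_def interior_open)
qed

lemma finite_skeleton_minus_disk: "j \<in> {1..N} \<Longrightarrow> finite (skeleton N c r j - \<Omega> j)"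
  by (rule finite_subset[OF skeleton_minus_disk_subset], assumption)
    (intro finite_UN_I finite_nbrs finite_nbr_circles)

text \<open>The set \<open>\<Gamma>\<^sub>i\<close> of (A1) lies in \<open>\<Omega>\<^sub>j\<close> and in no third disk. Apart from its points on further circles,
which are finitely many, it is contained in the arc \<open>\<Gamma>\<^sub>i\<^bsup>j,0\<^esup>\<close> and hence in \<open>S\<^sub>j\<close>.\<close>

lemma skeleton_positive_length:
  obtains j where "j \<in> {1..N}" "emeasure (arclength N c r) (skeleton N c r j) > 0"
proof -
  obtain i j where ij: "i \<in> {1..N}" "j \<in> {1..N}" "i \<noteq> j" "\<Omega> i \<inter> \<Omega> j \<noteq> {}"
    using config unfolding disk_configuration_def by metis
  obtain \<Gamma> where \<Gamma>: "\<Gamma> \<in> sets borel" "\<Gamma> \<subseteq> frontier (\<Omega> i) \<inter> \<Omega> j"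
      "emeasure (circle_measure (c i) (r i)) \<Gamma> > 0" "\<forall>k\<in>{1..N} - {i, j}. \<Gamma> \<inter> \<Omega> k = {}"
    using A1 ij unfolding assumption_A1_def by metis
  define F where "F = (\<Union>k\<in>Nb i. frontier (\<Omega> i) \<inter> frontier (\<Omega> k))"
  have F: "finite F" unfolding F_def by (intro finite_UN_I finite_nbrs finite_nbr_circles ij(1))
  have iNj: "i \<in> Nb j" using ij by (auto simp: nbrs_def)
  let ?A = "{x \<in> frontier (\<Omega> i). x \<in> \<Omega> j \<and> (\<forall>l \<in> Nb i - {j}. x \<notin> \<Omega> l)}"
  have "\<Gamma> - F \<subseteq> arc N c r i j 0"
  proof
    fix x assume x: "x \<in> \<Gamma> - F"
    let ?T = "frontier (\<Omega> i) \<inter> (\<Omega> j - (\<Union>l\<in>Nb i - {j}. closure (\<Omega> l)))"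
    have "x \<notin> closure (\<Omega> l)" if l: "l \<in> Nb i - {j}" for l
    proof -
      have "l \<in> {1..N} - {i, j}" using l nbrsD[of l i] by blast
      then have "x \<notin> \<Omega> l" using \<Gamma>(4) x by blast
      moreover have "x \<notin> frontier (\<Omega> l)" using x \<Gamma>(2) l by (auto simp: F_def)
      ultimately show ?thesis by (simp add: frontier_def interior_open)
    qed
    then have "x \<in> ?T" using x \<Gamma>(2) by blast
    moreover have op: "openin (top_of_set (frontier (\<Omega> i))) ?T"
      by (intro openin_open_Int open_Diff closed_UN) auto
    moreover have "?T \<subseteq> ?A" using closure_subset[THEN subsetD] by auto
    ultimately have "x \<in> bd_interior c r i ?A"
      unfolding bd_interior_def using interior_of_maximal[OF _ op] by blast
    then show "x \<in> arc N c r i j 0" by (simp add: arc_def)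
  qed
  also have "\<dots> \<subseteq> skeleton_part N c r j i"
    unfolding skeleton_part_def by (rule order_trans[OF _ closure_subset]) (auto simp: common_nbrs0_def)
  also have "\<dots> \<subseteq> skeleton N c r j" using iNj by (auto simp: skeleton_def)
  finally have sub: "\<Gamma> - F \<subseteq> skeleton N c r j" .
  have b: "skeleton N c r j \<in> sets borel" using closed_skeleton by (rule borel_closed)
  have "emeasure (circle_measure (c i) (r i)) (\<Gamma> - F) = emeasure (circle_measure (c i) (r i)) \<Gamma>"
    using \<Gamma>(1) circle_measure_finite_null[OF radius_pos[OF ij(1)] F]
    by (intro emeasure_Diff_null_set) auto
  then have "0 < emeasure (circle_measure (c i) (r i)) (\<Gamma> - F)" using \<Gamma>(3) by simp
  also have "\<dots> \<le> emeasure (circle_measure (c i) (r i)) (skeleton N c r j)"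
    using b by (intro emeasure_mono sub) simp
  also have "\<dots> \<le> emeasure (arclength N c r) (skeleton N c r j)"
    unfolding emeasure_arclength[OF b]
    using ij(1) by (intro member_le_sum[where f = "\<lambda>i. emeasure (circle_measure (c i) (r i)) (skeleton N c r j)"]) auto
  finally show thesis using that[OF ij(2)] by blast
qed

text \<open>The values of \<open>h\<close> outside \<open>\<Omega>\<^sub>j\<close> are arbitrary, but only finitely many points of the skeleton lie there.\<close>

lemma skeleton_measurable:
  assumes j: "j \<in> {1..N}" and h: "continuous_on (\<Omega> j) h"
  shows "(\<lambda>x. ereal (h x)) \<in> borel_measurable (restrict_space (arclength N c r) (skeleton N c r j))"
proof (rule measurable_discrete_difference)
  let ?M = "restrict_space (arclength N c r) (skeleton N c r j)"
  have "(\<lambda>x. indicator (\<Omega> j) x *\<^sub>R h x) \<in> borel_measurable borel"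
    by (rule borel_measurable_continuous_on_indicator[OF _ h]) auto
  then have "(\<lambda>x. indicator (\<Omega> j) x *\<^sub>R h x) \<in> borel_measurable (arclength N c r)"
    by (simp only: measurable_cong_sets[OF sets_arclength refl])
  then show "(\<lambda>x. ereal (indicator (\<Omega> j) x *\<^sub>R h x)) \<in> borel_measurable ?M"
    by (intro borel_measurable_ereal measurable_restrict_space1)
  show "countable (skeleton N c r j - \<Omega> j)"
    using finite_skeleton_minus_disk[OF j] by (rule countable_finite)
  show "{x} \<in> sets ?M" if "x \<in> skeleton N c r j - \<Omega> j" for x
    using that closed_skeleton by (subst sets_restrict_space_iff) (auto simp: borel_closed)
  show "ereal (indicator (\<Omega> j) x *\<^sub>R h x) = ereal (h x)"
    if "x \<in> space ?M" "x \<notin> skeleton N c r j - \<Omega> j" for x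
    using that by (auto simp: space_restrict_space)
qed auto

lemma skeleton_esssup_le:
  assumes j: "j \<in> {1..N}" and h: "continuous_on (\<Omega> j) h" and le: "\<And>x. x \<in> \<Omega> j \<Longrightarrow> h x \<le> C"
  shows "skeleton_esssup N c r j h \<le> ereal C"
  unfolding skeleton_esssup_def
proof (rule esssup_I[OF skeleton_measurable[OF j h]])
  have "AE x in arclength N c r. x \<notin> skeleton N c r j - \<Omega> j"
    by (intro AE_not_in arclength_finite_null finite_skeleton_minus_disk j)
  then have "AE x in arclength N c r. x \<in> skeleton N c r j \<longrightarrow> ereal (h x) \<le> ereal C"
    by eventually_elim (use le in auto)
  then show "AE x in restrict_space (arclength N c r) (skeleton N c r j). ereal (h x) \<le> ereal C"
    by (subst AE_restrict_space_iff) (auto simp: borel_closed closed_skeleton sets_eq_imp_space_eq[OF sets_arclength])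
qed

lemma skeleton_esssup_nonneg:
  assumes "emeasure (arclength N c r) (skeleton N c r j) > 0" and h: "\<And>x. 0 \<le> h x"
  shows "0 \<le> skeleton_esssup N c r j h"
proof -
  let ?M = "restrict_space (arclength N c r) (skeleton N c r j)"
  have "space ?M = skeleton N c r j"
    by (simp add: space_restrict_space sets_eq_imp_space_eq[OF sets_arclength])
  moreover have "emeasure ?M (skeleton N c r j) = emeasure (arclength N c r) (skeleton N c r j)"
    by (rule emeasure_restrict_space) (auto simp: borel_closed closed_skeleton sets_eq_imp_space_eq[OF sets_arclength])
  ultimately have "emeasure ?M (space ?M) \<noteq> 0" using assms(1) by auto
  then have "0 = esssup ?M (\<lambda>x. 0 :: ereal)" by (simp add: esssup_const)
  also have "\<dots> \<le> esssup ?M (\<lambda>x. ereal (h x))" by (rule esssup_mono) (use h in auto)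
  finally show ?thesis by (simp add: skeleton_esssup_def)
qed

end

section \<open>Convergence and the equivalence theorem\<close>

context disk_partition
begin

lemma schwarz_converges:
  assumes u: "solves_global N c r g u" and U: "schwarz_iterates N c r chi g u0 U"
  shows "(\<lambda>n. MAX j\<in>{1..N}. skeleton_esssup N c r j (\<lambda>x. \<bar>u x - U n j x\<bar>)) \<longlonglongrightarrow> 0"
proof -
  have U': "\<And>n j. j \<in> {1..N} \<Longrightarrow> solves_local N c r chi g j (U n) (U (Suc n) j)"
    using U by (simp add: schwarz_iterates_def)
  \<comment> \<open>The errors are followed from the first step on, where they are bounded because the iterates are.\<close>
  define W where "W = (\<lambda>n j x. u x - U (Suc n) j x)"
  have W: "solves_local N c r chi (\<lambda>_. 0) j (W n) (W (Suc n) j)" if "j \<in> {1..N}" for n j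
    unfolding W_def by (rule error_solves_local[OF u that U'[OF that]])
  have bh: "bounded_harmonic_on (W n j) (\<Omega> j)" if "j \<in> {1..N}" for n j
    using error_solves_local[OF u that U'[OF that, of n]] by (simp add: W_def solves_local_def)
  have "bounded (\<Union>i\<in>{1..N}. W 0 i ` \<Omega> i)"
    using bh by (intro bounded_UN) (auto simp: bounded_harmonic_on_def)
  then obtain M where M: "\<And>i x. i \<in> {1..N} \<Longrightarrow> x \<in> \<Omega> i \<Longrightarrow> \<bar>W 0 i x\<bar> \<le> M"
    unfolding bounded_iff by fastforce
  obtain \<theta> C where \<theta>: "0 \<le> \<theta>" "\<theta> < 1"
    "\<And>n j x. j \<in> {1..N} \<Longrightarrow> x \<in> \<Omega> j \<Longrightarrow> \<bar>W (Suc n) j x\<bar> \<le> C * \<theta> ^ n"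
    by (rule error_geometric_decay[of W, OF W M]) iprover+
  let ?E = "\<lambda>n j. skeleton_esssup N c r j (\<lambda>x. \<bar>u x - U n j x\<bar>)"
  obtain k where k: "k \<in> {1..N}" "emeasure (arclength N c r) (skeleton N c r k) > 0"
    by (rule skeleton_positive_length)
  have lower: "0 \<le> (MAX j\<in>{1..N}. ?E n j)" for n
    using skeleton_esssup_nonneg[OF k(2), of "\<lambda>x. \<bar>u x - U n k x\<bar>"] k(1)
    by (intro order_trans[OF _ Max_ge]) auto
  have upper: "(MAX j\<in>{1..N}. ?E (Suc (Suc n)) j) \<le> ereal (C * \<theta> ^ n)" for n
  proof (rule Max.boundedI)
    fix a assume "a \<in> ?E (Suc (Suc n)) ` {1..N}"
    then obtain j where j: "j \<in> {1..N}" "a = ?E (Suc (Suc n)) j" by blast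
    have "continuous_on (\<Omega> j) (W (Suc n) j)"
      using bh[OF j(1)] harmonic_on_imp_continuous_on by (auto simp: bounded_harmonic_on_def)
    then have "continuous_on (\<Omega> j) (\<lambda>x. \<bar>W (Suc n) j x\<bar>)" by (intro continuous_intros)
    then show "a \<le> ereal (C * \<theta> ^ n)"
      using skeleton_esssup_le[OF j(1), of "\<lambda>x. \<bar>W (Suc n) j x\<bar>"] \<theta>(3)[OF j(1)] j(2)
      by (simp add: W_def)
  qed (use k(1) in auto)
  have "(\<lambda>n. C * \<theta> ^ n) \<longlonglongrightarrow> C * 0"
    using \<theta>(1,2) by (intro tendsto_intros LIMSEQ_power_zero) simp
  then have "(\<lambda>n. ereal (C * \<theta> ^ n)) \<longlonglongrightarrow> 0" by (simp add: zero_ereal_def)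
  then have "(\<lambda>n. MAX j\<in>{1..N}. ?E (Suc (Suc n)) j) \<longlonglongrightarrow> 0"
    by (rule tendsto_sandwich[OF always_eventually[OF allI] always_eventually[OF allI] tendsto_const, rotated 2])
      (rule lower, rule upper)
  then show ?thesis by (rule LIMSEQ_imp_Suc[OF LIMSEQ_imp_Suc])
qed

end

theorem theorem2p12:
  fixes N :: nat and c :: "nat \<Rightarrow> complex" and r :: "nat \<Rightarrow> real"
    and chi :: "nat \<Rightarrow> nat \<Rightarrow> complex \<Rightarrow> real" and g u :: "complex \<Rightarrow> real"
  assumes "disk_configuration N c r"
    and "assumption_A1 N c r"
    and "assumption_A2 N c r"
    and "partition_of_unity N c r chi"
    and "continuous_on (frontier (domain N c r)) g"
    and "solves_global N c r g u"
  shows "solves_decomposed N c r chi g (\<lambda>j. restrict u (disk c r j)) \<and>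
    (\<forall>v. solves_decomposed N c r chi g v \<longrightarrow> (\<forall>j\<in>{1..N}. \<forall>x \<in> disk c r j. v j x = u x)) \<and>
    (\<forall>u0 U. continuous_on (closure (domain N c r)) u0 \<and> schwarz_iterates N c r chi g u0 U \<longrightarrow>
      (\<lambda>n. MAX j\<in>{1..N}. skeleton_esssup N c r j (\<lambda>x. \<bar>u x - U n j x\<bar>)) \<longlonglongrightarrow> 0)"
proof -
  interpret disk_partition N c r chi
    using assms(1,2,4) by unfold_locales
  show ?thesis
  proof (intro conjI allI impI ballI)
    show "solves_decomposed N c r chi g (\<lambda>j. restrict u (disk c r j))"
      by (rule restriction_solves_decomposed[OF assms(6)])
    show "v j x = u x" if "solves_decomposed N c r chi g v" "j \<in> {1..N}" "x \<in> disk c r j" for v j x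
      using decomposed_unique[OF assms(6) that] .
    show "(\<lambda>n. MAX j\<in>{1..N}. skeleton_esssup N c r j (\<lambda>x. \<bar>u x - U n j x\<bar>)) \<longlonglongrightarrow> 0"
      if "continuous_on (closure (domain N c r)) u0 \<and> schwarz_iterates N c r chi g u0 U" for u0 U
      using schwarz_converges[OF assms(6) conjunct2[OF that]] .
  qed
qed

end
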